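(* There exists a unique linear map $\mathcal{B}:\mathbb{C}[M_{n,n}]\to \mathbf{U}(gl(n))$ such that $\mathcal{B}\big((S|T)\big)=[S|T]$ for every pair $S,T$ of Young tableaux on $\{1,\dots,n\}$ of the same shape.
   Context: $\mathbb{C}[M_{n,n}]$ is the polynomial algebra in the commuting indeterminates $(i|j)$, $1\le i,j\le n$ (identified with $\mathbf{Sym}(gl(n))$ via $e_{ij}\mapsto (i|j)$, where $e_{ij}$ are the matrix units of $gl(n)$). A Young tableau $S$ of shape $\lambda=(\lambda_1\ge\dots\ge\lambda_m>0)$ on an alphabet is a sequence of words $(\omega_1,\dots,\omega_m)$ with $\ell(\omega_r)=\lambda_r$ (repetitions allowed). For words $\omega=i_1\cdots i_p$, $\varpi=j_1\cdots j_p$ on $\{1,\dots,n\}$, the biproduct is $(\omega|\varpi)=(-1)^{\binom p2}\det\big((i_r|j_s)\big)_{r,s=1}^p$. For tableaux $S=(\omega_1,\dots,\omega_m)$, $T=(\varpi_1,\dots,\varpi_m)$ of the same shape, the bitableau is $(S|T)=(-1)^{\sum_{k=2}^m\ell(\omega_k)(\ell(\varpi_1)+\cdots+\ell(\varpi_{k-1}))}(\omega_1|\varpi_1)\cdots(\omega_m|\varpi_m)$. Capelli bitableaux (virtual variables). Let $A_0=\{\alpha_1,\dots,\alpha_{m_0}\}$ (positive virtual symbols, parity $0$), $A_1=\{\beta_1,\dots,\beta_{m_1}\}$ (negative virtual symbols, parity $1$), $L=\{1,\dots,n\}$ (proper symbols, parity $1$), with $m_0,m_1$ sufficiently large. Let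 $gl(m_0|m_1+n)$ be the Lie superalgebra with homogeneous basis $e_{a,b}$ ($a,b\in A_0\cup A_1\cup L$) of parity $|a|+|b|\bmod 2$ and superbracket $[e_{a,b},e_{c,d}]=\delta_{bc}e_{a,d}-(-1)^{(|a|+|b|)(|c|+|d|)}\delta_{ad}e_{c,b}$; the $e_{i,j}$, $i,j\in L$, span a copy of $gl(n)$, so $\mathbf{U}(gl(n))\subset\mathbf{U}(gl(m_0|m_1+n))$. A product $e_{a_m,b_m}\cdots e_{a_1,b_1}$ is irregular if there are $i\le m$ and $\gamma\in A_0\cup A_1$ with $\#\{j\le i: b_j=\gamma\}>\#\{j<i:a_j=\gamma\}$. Let $\mathbf{Irr}$ be the left ideal generated by irregular products. It is known that $\mathbf{U}(gl(n))+\mathbf{Irr}$ is a direct sum and a subalgebra $Virt$ in which $\mathbf{Irr}$ is a two-sided ideal; the Capelli devirtualization map $\mathfrak p:Virt\to\mathbf{U}(gl(n))$ is the projection with kernel $\mathbf{Irr}$. For tableaux $S,T$ of the same shape on $A_0\cup A_1\cup L$, $e_{S,T}$ is the product, over rows from first to last and within each row from left to right, of $e_{s,t}$ with $s,t$ the corresponding entries of $S,T$. For a shape $\lambda$ with $m$ rows, $C_\lambda$ is the tableau of shape $\lambda$ whose $r$-th row is $\alpha_r$ repeated $\lambda_r$ times. The Capelli bitableau is $[S|T]=\mathfrak p(e_{S,C_\lambda}e_{C_\lambda,T})\in\mathbf{U}(gl(n))$ for $S,T$ of shape $\lambda$ on $L$. *)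

theory Defs
  imports "HOL-Library.Poly_Mapping" "HOL-Combinatorics.Permutations" Complex_Main
begin

text \<open>The proper alphabet L = {1,...,n} is modelled by an arbitrary finite type 'l
  (n = CARD('l)).  C[M_{n,n}] is the commutative polynomial algebra in the
  indeterminates (i|j), i,j in 'l: finitely supported functions from monomials
  (finitely supported exponent functions on 'l x 'l) to complex numbers.\<close>

type_synonym 'l cpoly = "(('l \<times> 'l) \<Rightarrow>\<^sub>0 nat) \<Rightarrow>\<^sub>0 complex"

definition pvar :: "'l \<Rightarrow> 'l \<Rightarrow> 'l cpoly" where
  "pvar i j = Poly_Mapping.single (Poly_Mapping.single (i, j) 1) 1"

definition pconst :: "complex \<Rightarrow> 'l cpoly" where
  "pconst c = Poly_Mapping.single 0 c"

definition biproduct :: "'l list \<Rightarrow> 'l list \<Rightarrow> 'l cpoly" where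
  "biproduct w v = (let p = length w in
     (-1) ^ (p choose 2) *
     (\<Sum>\<sigma> \<in> {\<sigma>. \<sigma> permutes {..<p}}.
        of_int (sign \<sigma>) * (\<Prod>r<p. pvar (w ! r) (v ! (\<sigma> r)))))"

text \<open>Tableaux: a tableau is the list of its row words.\<close>
definition shape :: "'a list list \<Rightarrow> nat list" where
  "shape S = map length S"

definition young_tableau :: "'a list list \<Rightarrow> bool" where
  "young_tableau S \<longleftrightarrow> sorted_wrt (\<ge>) (shape S) \<and> (\<forall>w \<in> set S. w \<noteq> [])"

definition bitableau :: "'l list list \<Rightarrow> 'l list list \<Rightarrow> 'l cpoly" where
  "bitableau S T =
     (-1) ^ (\<Sum>k\<in>{1..<length S}. length (S ! k) * (\<Sum>h<k. length (T ! h))) *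
     (\<Prod>r<length S. biproduct (S ! r) (T ! r))"

text \<open>Symbols: positive virtual symbols alpha_k (parity 0), negative virtual symbols
  beta_k (parity 1), proper symbols (parity 1).  We take countably many virtual
  symbols of each kind (m_0, m_1 "sufficiently large").\<close>

datatype 'l sym = Alpha nat | Beta nat | Prop 'l

fun spar :: "'l sym \<Rightarrow> nat" where
  "spar (Alpha _) = 0"
| "spar (Beta _) = 1"
| "spar (Prop _) = 1"

fun is_virtual :: "'l sym \<Rightarrow> bool" where
  "is_virtual (Prop _) = False"
| "is_virtual _ = True"

fun is_proper :: "'l sym \<Rightarrow> bool" where
  "is_proper (Prop _) = True"
| "is_proper _ = False"

text \<open>A letter (a,b) stands for the basis element e_{a,b}; a word stands for the
  product of its letters (left to right).\<close>
type_synonym 'l letter = "'l sym \<times> 'l sym"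
type_synonym 'l falg = "'l letter list \<Rightarrow>\<^sub>0 complex"

definition lpar :: "'l letter \<Rightarrow> nat" where
  "lpar x = (spar (fst x) + spar (snd x)) mod 2"

definition fword :: "'l letter list \<Rightarrow> 'l falg" where
  "fword w = Poly_Mapping.single w 1"

definition gen :: "'l letter \<Rightarrow> 'l falg" where
  "gen x = fword [x]"

definition fmul :: "'l falg \<Rightarrow> 'l falg \<Rightarrow> 'l falg" where
  "fmul p q = (\<Sum>(u, v) \<in> Poly_Mapping.keys p \<times> Poly_Mapping.keys q.
                 Poly_Mapping.single (u @ v) (Poly_Mapping.lookup p u * Poly_Mapping.lookup q v))"

definition fconst :: "complex \<Rightarrow> 'l falg" where
  "fconst c = Poly_Mapping.single [] c"

text \<open>Defining relation of U(gl(m_0|m_1+n)):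
  XY - (-1)^{|X||Y|} YX = [X,Y] for X = e_{a,b}, Y = e_{c,d}.\<close>
definition srel :: "'l letter \<Rightarrow> 'l letter \<Rightarrow> 'l falg" where
  "srel x y = (let \<epsilon> = (-1) ^ (lpar x * lpar y) :: complex in
     fmul (gen x) (gen y) - fmul (fconst \<epsilon>) (fmul (gen y) (gen x))
     - ((if snd x = fst y then gen (fst x, snd y) else 0)
        - fmul (fconst \<epsilon>) (if fst x = snd y then gen (fst y, snd x) else 0)))"

text \<open>Two-sided ideal generated by the relations; U(gl(m_0|m_1+n)) = falg / Kid.\<close>
inductive_set Kid :: "'l falg set" where
  Kid_zero: "0 \<in> Kid"
| Kid_add: "p \<in> Kid \<Longrightarrow> q \<in> Kid \<Longrightarrow> p + q \<in> Kid"
| Kid_gen: "fmul (fmul u (srel x y)) v \<in> Kid"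

text \<open>Irregular products.  For the product e_{a_m,b_m} ... e_{a_1,b_1}, written as
  the word w (left to right), the letter (a_j,b_j) is (rev w) ! (j-1).\<close>
definition irregular :: "'l letter list \<Rightarrow> bool" where
  "irregular w \<longleftrightarrow> (let v = rev w in
     \<exists>i < length v. \<exists>\<gamma>. is_virtual \<gamma> \<and>
       card {j. j \<le> i \<and> snd (v ! j) = \<gamma>} > card {j. j < i \<and> fst (v ! j) = \<gamma>})"

text \<open>Preimage in the free algebra of the left ideal Irr of U(gl(m_0|m_1+n))
  generated by irregular products.\<close>
inductive_set IrrF :: "'l falg set" where
  IrrF_K: "p \<in> Kid \<Longrightarrow> p \<in> IrrF"
| IrrF_add: "p \<in> IrrF \<Longrightarrow> q \<in> IrrF \<Longrightarrow> p + q \<in> IrrF"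
| IrrF_gen: "irregular w \<Longrightarrow> fmul u (fword w) \<in> IrrF"

text \<open>Representatives of elements of the subalgebra U(gl(n)) (generated by the e_{i,j},
  i,j proper): linear combinations of words in proper letters.\<close>
definition in_Ugln :: "'l falg \<Rightarrow> bool" where
  "in_Ugln u \<longleftrightarrow> (\<forall>w \<in> Poly_Mapping.keys u. \<forall>x \<in> set w. is_proper (fst x) \<and> is_proper (snd x))"

text \<open>The word e_{S,C_\<lambda>} e_{C_\<lambda>,T}; row r (0-based) of C_\<lambda> consists of Alpha r.\<close>
definition capelli_word :: "'l list list \<Rightarrow> 'l list list \<Rightarrow> 'l letter list" where
  "capelli_word S T =
     concat (map (\<lambda>r. map (\<lambda>s. (Prop s, Alpha r)) (S ! r)) [0..<length S]) @
     concat (map (\<lambda>r. map (\<lambda>t. (Alpha r, Prop t)) (T ! r)) [0..<length T])"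

text \<open>u represents the Capelli bitableau [S|T] = p(e_{S,C} e_{C,T}): u lies in U(gl(n))
  and e_{S,C} e_{C,T} - u lies in Irr (the kernel of the devirtualization p).\<close>
definition is_capelli_bitableau :: "'l list list \<Rightarrow> 'l list list \<Rightarrow> 'l falg \<Rightarrow> bool" where
  "is_capelli_bitableau S T u \<longleftrightarrow>
     in_Ugln u \<and> fword (capelli_word S T) - u \<in> IrrF"

text \<open>A map f represents a C-linear map C[M_{n,n}] \<rightarrow> U(gl(n)) (values taken modulo Kid).\<close>
definition linear_to_U :: "('l cpoly \<Rightarrow> 'l falg) \<Rightarrow> bool" where
  "linear_to_U f \<longleftrightarrow> (\<forall>p. in_Ugln (f p)) \<and>
     (\<forall>p q. f (p + q) - (f p + f q) \<in> Kid) \<and>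
     (\<forall>c p. f (pconst c * p) - fmul (fconst c) (f p) \<in> Kid)"

definition maps_bitableaux_to_capelli :: "('l cpoly \<Rightarrow> 'l falg) \<Rightarrow> bool" where
  "maps_bitableaux_to_capelli f \<longleftrightarrow>
     (\<forall>S T. young_tableau S \<and> young_tableau T \<and> shape S = shape T \<longrightarrow>
        is_capelli_bitableau S T (f (bitableau S T)))"

end

theory Submission
  imports Defs "Jordan_Normal_Form.Determinant"
begin

text \<open>
  Uniqueness: up to sign every monomial is the bitableau of a one-column shape, so it suffices that
  \<open>U(gl(n))\<close> meets \<open>Irr\<close> only in 0.  The superalgebra acts on tensor powers of its natural
  representation (enlarged by a trivial summand).  Irregular products kill the tensors without virtual
  entries, because they annihilate a symbol that is not there, whereas \<open>U(gl(n))\<close> acts on these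
  tensors faithfully.

  Existence: the map is prescribed on monomials by one-column tableaux, so all Capelli bitableaux have
  to be expanded into one-column ones as the bitableaux are.  Modulo \<open>Irr\<close> the first \<open>e(s, c)\<close> of
  \<open>e(S, C) e(C, T)\<close> can be replaced by \<open>e(s, c')\<close> with a fresh \<open>c'\<close> when the product is summed
  over the ways of replacing one \<open>e(c, t)\<close> by \<open>e(c', t)\<close>.  Moving that letter to the front yields
  the signs of the Laplace expansion of a determinant along its first row.
\<close>

section \<open>The free algebra and its ideals\<close>

text \<open>The trivial summand serves the diagonal letters. The letter \<open>(j, j)\<close> fixes
  the vector \<open>j\<close>, so no linear form that vanishes at \<open>j\<close> can detect it.
  The difference of \<open>j\<close> and \<open>None\<close> is also sent to \<open>j\<close>, and
  there are forms that vanish at this difference but not at \<open>j\<close>. A product of such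
  forms vanishes unless every tensor factor is hit by its own letter, and this isolates the longest
  words of an element. \<open>None\<close> is odd so that the difference is homogeneous.

  \<open>Irr\<close> is a left ideal of the superalgebra, so relations modulo \<open>Irr\<close> are
  multiplied from the left alone. A word is discarded only where nothing to the right of some letter
  creates the virtual symbol that this letter annihilates; polarizations are therefore driven to the
  right end.

  All shapes can be expanded uniformly because the signs of a bitableau combine to a power of -1
  that depends only on the number of its entries.\<close>

text \<open>With this instance \<^const>\<open>fmul\<close> is the ring multiplication of finitely supported functions.\<close>
instantiation list :: (type) monoid_add
begin
definition zero_list :: "'a list" where "zero_list = []"
definition plus_list :: "'a list \<Rightarrow> 'a list \<Rightarrow> 'a list" where "plus_list = (@)"
instance by standard (simp_all add: zero_list_def plus_list_def)
end

lemma poly_mapping_eq_sum_single: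
  "p = (\<Sum>k\<in>Poly_Mapping.keys p. Poly_Mapping.single k (Poly_Mapping.lookup p k))"
proof (rule poly_mapping_eqI)
  fix k
  have "(\<Sum>j\<in>Poly_Mapping.keys p. Poly_Mapping.lookup (Poly_Mapping.single j (Poly_Mapping.lookup p j)) k)
      = (\<Sum>j\<in>Poly_Mapping.keys p. if j = k then Poly_Mapping.lookup p k else 0)"
    by (rule sum.cong) (auto simp: lookup_single when_def)
  then show "Poly_Mapping.lookup p k = Poly_Mapping.lookup (\<Sum>k\<in>Poly_Mapping.keys p. Poly_Mapping.single k (Poly_Mapping.lookup p k)) k"
    by (simp add: lookup_sum in_keys_iff)
qed

lemma single_induct [case_names zero add]:
  assumes "P 0" and "\<And>k c p. P p \<Longrightarrow> P (Poly_Mapping.single k c + p)"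
  shows "P (p :: 'a \<Rightarrow>\<^sub>0 'b::comm_monoid_add)"
proof -
  have "P (\<Sum>k\<in>A. Poly_Mapping.single k (Poly_Mapping.lookup p k))" if "finite A" for A
    using that by (induction A rule: finite_induct) (auto intro: assms)
  from this[of "Poly_Mapping.keys p"] show ?thesis
    by (simp flip: poly_mapping_eq_sum_single)
qed

lemma fmul_eq_times: "fmul p q = p * q"
proof -
  have "p * q = (\<Sum>u\<in>Poly_Mapping.keys p. \<Sum>v\<in>Poly_Mapping.keys q.
      Poly_Mapping.single u (Poly_Mapping.lookup p u) * Poly_Mapping.single v (Poly_Mapping.lookup q v))"
    by (subst poly_mapping_eq_sum_single[of p], subst poly_mapping_eq_sum_single[of q])
       (simp add: sum_product)
  then show ?thesis
    by (simp add: fmul_def mult_single plus_list_def sum.cartesian_product)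
qed

lemma fword_append: "fword (u @ v) = fword u * fword v"
  by (simp add: fword_def mult_single plus_list_def)

lemma fword_Cons: "fword (x # v) = fword [x] * fword v"
  using fword_append[of "[x]" v] by simp

lemma fconst_0 [simp]: "fconst 0 = 0"
  by (simp add: fconst_def)

lemma fconst_1 [simp]: "fconst 1 = 1"
  by (metis fconst_def single_one zero_list_def)

lemma fconst_add: "fconst (a + b) = fconst a + fconst b"
  by (simp add: fconst_def single_add)

lemma fconst_uminus: "fconst (- a) = - fconst a"
  by (simp add: fconst_def single_uminus)

lemma fconst_mult: "fconst (a * b) = fconst a * fconst b"
  by (simp add: fconst_def mult_single plus_list_def)

lemma fconst_neg_one_power [simp]: "fconst ((- 1) ^ k) = (- 1) ^ k"
  by (induction k) (simp_all add: fconst_uminus fconst_mult)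

lemma fconst_commute: "fconst c * p = p * fconst c"
  by (induction p rule: single_induct)
     (simp_all add: fconst_def mult_single plus_list_def algebra_simps)

lemma single_eq_fconst_fword: "Poly_Mapping.single w c = fconst c * fword w"
  by (simp add: fconst_def fword_def mult_single plus_list_def)

lemma lookup_fconst_mult:
  "Poly_Mapping.lookup (fconst c * p) w = c * Poly_Mapping.lookup p w"
proof (induction p rule: single_induct)
  case (add k a p)
  then show ?case
    by (simp add: distrib_left lookup_add fconst_def mult_single plus_list_def lookup_single when_def)
qed simp

lemma Kid_mult_left: "p \<in> Kid \<Longrightarrow> r * p \<in> Kid"
proof (induction rule: Kid.induct)
  case (Kid_gen u x y v)
  then show ?case using Kid.Kid_gen[of "r * u" x y v] by (simp add: fmul_eq_times mult.assoc)
qed (simp_all add: Kid.intros distrib_left)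

lemma Kid_uminus: "p \<in> Kid \<Longrightarrow> - p \<in> Kid"
  using Kid_mult_left[of p "- 1"] by simp

lemma Kid_diff: "p \<in> Kid \<Longrightarrow> q \<in> Kid \<Longrightarrow> p - q \<in> Kid"
  using Kid_add[of p "- q"] Kid_uminus[of q] by simp

lemma IrrF_mult_left: "p \<in> IrrF \<Longrightarrow> r * p \<in> IrrF"
proof (induction rule: IrrF.induct)
  case (IrrF_gen w u)
  then show ?case using IrrF.IrrF_gen[of w "r * u"] by (simp add: fmul_eq_times mult.assoc)
qed (auto intro: IrrF.intros Kid_mult_left simp: distrib_left)

lemma IrrF_uminus: "p \<in> IrrF \<Longrightarrow> - p \<in> IrrF"
  using IrrF_mult_left[of p "- 1"] by simp

lemma IrrF_zero: "0 \<in> IrrF"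
  by (intro IrrF_K Kid_zero)

lemma IrrF_sum: "(\<And>i. i \<in> I \<Longrightarrow> f i \<in> IrrF) \<Longrightarrow> sum f I \<in> IrrF"
  by (induction I rule: infinite_finite_induct) (auto intro: IrrF_zero IrrF_add)

lemma IrrF_trans: "p - q \<in> IrrF \<Longrightarrow> q - r \<in> IrrF \<Longrightarrow> p - r \<in> IrrF"
  using IrrF_add[of "p - q" "q - r"] by simp

lemma IrrF_sym: "p - q \<in> IrrF \<Longrightarrow> q - p \<in> IrrF"
  using IrrF_uminus[of "p - q"] by simp

lemma irregular_in_IrrF: "irregular w \<Longrightarrow> fword w \<in> IrrF"
  using IrrF_gen[of w 1] by (simp add: fmul_eq_times)

lemma in_Ugln_0: "in_Ugln 0"
  by (simp add: in_Ugln_def)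

lemma in_Ugln_add: "in_Ugln p \<Longrightarrow> in_Ugln q \<Longrightarrow> in_Ugln (p + q)"
  using keys_add[of p q] by (fastforce simp: in_Ugln_def)

lemma in_Ugln_fconst_mult: "in_Ugln p \<Longrightarrow> in_Ugln (fconst c * p)"
  by (auto simp: in_Ugln_def in_keys_iff lookup_fconst_mult)

lemma in_Ugln_uminus: "in_Ugln p \<Longrightarrow> in_Ugln (- p)"
  using in_Ugln_fconst_mult[of p "- 1"] by (simp add: fconst_uminus)

lemma in_Ugln_diff: "in_Ugln p \<Longrightarrow> in_Ugln q \<Longrightarrow> in_Ugln (p - q)"
  using in_Ugln_add[of p "- q"] in_Ugln_uminus[of q] by simp

lemma in_Ugln_sum: "(\<And>i. i \<in> I \<Longrightarrow> in_Ugln (f i)) \<Longrightarrow> in_Ugln (sum f I)"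
  by (induction I rule: infinite_finite_induct) (auto intro: in_Ugln_0 in_Ugln_add)

text \<open>The defining relation inside a word: exchanging two neighbouring letters costs the sign
  and a bracket, which is shorter by one letter.\<close>
lemma fword_swap:
  "fword (u @ (a, b) # (p, q) # v)
     - (fconst ((-1) ^ (lpar (a, b) * lpar (p, q))) * fword (u @ (p, q) # (a, b) # v)
        + (if b = p then fword (u @ (a, q) # v) else 0)
        - fconst ((-1) ^ (lpar (a, b) * lpar (p, q))) * (if a = q then fword (u @ (p, b) # v) else 0)) \<in> Kid"
proof -
  have *: "fword (u @ x # v) = fword u * (fword [x] * fword v)"
          "fword (u @ x # y # v) = fword u * (fword [x] * (fword [y] * fword v))" for x y
    by (simp_all add: fword_append fword_Cons[of _ v] fword_Cons[of _ "_ # v"])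
  have c: "fword u * ((- 1) ^ k * r) = (-1) ^ k * (fword u * r)" for k and r :: "'a falg"
    by (metis fconst_commute fconst_neg_one_power mult.assoc)
  show ?thesis
    using Kid_gen[of "fword u" "(a, b)" "(p, q)" "fword v"]
    by (simp add: * srel_def Let_def fmul_eq_times gen_def algebra_simps c split: if_splits)
qed

section \<open>Action on tensor powers\<close>

text \<open>A word acts on the tensor powers of the superspace spanned by the symbols and one additional odd
  vector \<open>None\<close> that all letters annihilate; lists index a basis.  The basis vector
  \<open>Some a\<close> of a proper symbol stands for the difference of the vector \<open>a\<close> and \<open>None\<close>,
  which is why the letter \<open>(a, b)\<close> sends \<open>Some b\<close> to \<open>Some a + None\<close>.  Functions of lists
  are linear forms, on which words act from the right.\<close>

fun opar :: "'l sym option \<Rightarrow> nat" where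
  "opar None = 1"
| "opar (Some a) = spar a"

definition subst :: "'l sym \<Rightarrow> ('l sym option \<Rightarrow> complex) \<Rightarrow> complex" where
  "subst a H = H (Some a) + (if is_proper a then H None else 0)"

fun act :: "'l letter \<Rightarrow> ('l sym option list \<Rightarrow> complex) \<Rightarrow> 'l sym option list \<Rightarrow> complex" where
  "act x F [] = 0"
| "act x F (c # cs) = (if c = Some (snd x) then subst (fst x) (\<lambda>z. F (z # cs)) else 0)
     + (- 1) ^ (lpar x * opar c) * act x (\<lambda>cs. F (c # cs)) cs"

lemma act_zero: "act x (\<lambda>_. 0) c = 0"
  by (induction c) (simp_all add: subst_def)

lemma act_add: "act x (\<lambda>c. F c + G c) c = act x F c + act x G c"
  by (induction c arbitrary: F G) (simp_all add: subst_def algebra_simps)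

lemma act_scale: "act x (\<lambda>c. a * F c) c = a * act x F c"
  by (induction c arbitrary: F) (simp_all add: subst_def algebra_simps)

lemma act_subst:
  "act y (\<lambda>c. subst a (\<lambda>z. F (z # c))) cs = subst a (\<lambda>z. act y (\<lambda>c. F (z # c)) cs)"
  by (simp add: subst_def act_add act_zero)

lemma subst_act:
  "subst a (\<lambda>z. act x F (z # cs)) =
     (if a = snd x then subst (fst x) (\<lambda>z. F (z # cs)) else 0)
     + (- 1) ^ (lpar x * spar a) * subst a (\<lambda>z. act x (\<lambda>cs. F (z # cs)) cs)"
  by (cases a) (auto simp: subst_def algebra_simps)

lemma neg_one_power_cong: "even (m + n) \<Longrightarrow> (- 1 :: complex) ^ m = (- 1) ^ n"
  by (simp add: minus_one_power_iff)

text \<open>Letters acting on different entries supercommute; what remains is both letters acting on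
  the same entry, and this is the bracket. The order is reversed because a form is composed with the
  left letter of a product first.\<close>

lemma act_bracket:
  fixes x y :: "'l letter"
  defines "e \<equiv> (- 1 :: complex) ^ (lpar x * lpar y)"
  shows "act y (act x F) c - e * act x (act y F) c
     = (if snd x = fst y then act (fst x, snd y) F c else 0)
       - e * (if fst x = snd y then act (fst y, snd x) F c else 0)"
proof (induction c arbitrary: F)
  case (Cons c cs)
  obtain a b p q where xy: "x = (a, b)" "y = (p, q)" by (cases x; cases y) auto
  \<comment> \<open>As \<open>lpar\<close> adds the parities of both symbols modulo 2, the sign for
    passing an entry changes exactly by \<open>e\<close> when the other letter has replaced that
    entry.\<close>
  have s1: "(-1) ^ (lpar x * spar p) = e * (-1) ^ (lpar x * spar q)"
    unfolding e_def xy lpar_def power_add[symmetric]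
    by (rule neg_one_power_cong) (auto simp add: even_add)
  have s2: "(-1) ^ (lpar y * spar b) = e * (-1) ^ (lpar y * spar a)"
    unfolding e_def xy lpar_def power_add[symmetric]
    by (rule neg_one_power_cong) (auto simp add: even_add)
  have s3: "(-1::complex) ^ (lpar (a, q) * k) = (-1) ^ (lpar x * k) * (-1) ^ (lpar y * k)" if "b = p" for k
    unfolding xy lpar_def power_add[symmetric]
    by (rule neg_one_power_cong) (use that in \<open>auto simp add: even_add\<close>)
  have s4: "(-1::complex) ^ (lpar (p, b) * k) = (-1) ^ (lpar x * k) * (-1) ^ (lpar y * k)" if "a = q" for k
    unfolding xy lpar_def power_add[symmetric]
    by (rule neg_one_power_cong) (use that in \<open>auto simp add: even_add\<close>)
  have L: "act y (act x F) (c # cs) =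
     (if c = Some q then subst p (\<lambda>z. act x F (z # cs)) else 0)
     + (-1) ^ (lpar y * opar c) * ((if c = Some b then subst a (\<lambda>z. act y (\<lambda>d. F (z # d)) cs) else 0)
       + (-1) ^ (lpar x * opar c) * act y (act x (\<lambda>d. F (c # d))) cs)"
    if "x = (a, b)" "y = (p, q)" for x y a b p q
    using that by (simp add: act_add act_scale act_subst act_zero)
  let ?G = "\<lambda>d. F (c # d)"
  let ?X = "(-1) ^ (lpar x * opar c)" and ?Y = "(-1) ^ (lpar y * opar c)"
  have "act y (act x F) (c # cs) - e * act x (act y F) (c # cs)
      = ?X * ?Y * (act y (act x ?G) cs - e * act x (act y ?G) cs)
       + (if c = Some q then if b = p then subst a (\<lambda>z. F (z # cs)) else 0 else 0)
       - e * (if c = Some b then if a = q then subst p (\<lambda>z. F (z # cs)) else 0 else 0)"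
    unfolding L[OF xy] L[OF xy(2,1)] subst_act
    using s1 s2 by (auto simp: xy algebra_simps)
  also have "\<dots> = (if snd x = fst y then act (fst x, snd y) F (c # cs) else 0)
       - e * (if fst x = snd y then act (fst y, snd x) F (c # cs) else 0)"
    unfolding Cons.IH using s3[of "opar c"] s4[of "opar c"] by (auto simp: xy algebra_simps)
  finally show ?case .
qed simp

abbreviation act_word :: "'l letter list \<Rightarrow> ('l sym option list \<Rightarrow> complex) \<Rightarrow> 'l sym option list \<Rightarrow> complex" where
  "act_word w F \<equiv> fold act w F"

lemma act_word_add: "act_word w (\<lambda>c. F c + G c) = (\<lambda>c. act_word w F c + act_word w G c)"
proof (induction w arbitrary: F G)
  case (Cons x w)
  have "act x (\<lambda>c. F c + G c) = (\<lambda>c. act x F c + act x G c)" by (rule ext) (rule act_add)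
  then show ?case by (simp add: Cons.IH)
qed simp

lemma act_word_scale: "act_word w (\<lambda>c. a * F c) = (\<lambda>c. a * act_word w F c)"
proof (induction w arbitrary: F)
  case (Cons x w)
  have "act x (\<lambda>c. a * F c) = (\<lambda>c. a * act x F c)" by (rule ext) (rule act_scale)
  then show ?case by (simp add: Cons.IH)
qed simp

lemma act_word_zero: "act_word w (\<lambda>_. 0) = (\<lambda>_. 0)"
  using act_word_scale[of w 0 "\<lambda>_. 0"] by simp

lemma act_word_sum: "act_word w (\<lambda>c. \<Sum>i\<in>I. F i c) = (\<lambda>c. \<Sum>i\<in>I. act_word w (F i) c)"
  by (induction I rule: infinite_finite_induct) (simp_all add: act_word_zero act_word_add)

definition act_alg :: "'l falg \<Rightarrow> ('l sym option list \<Rightarrow> complex) \<Rightarrow> 'l sym option list \<Rightarrow> complex" where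
  "act_alg p F c = (\<Sum>w\<in>Poly_Mapping.keys p. Poly_Mapping.lookup p w * act_word w F c)"

lemma act_alg_superset:
  assumes "finite A" "Poly_Mapping.keys p \<subseteq> A"
  shows "act_alg p F c = (\<Sum>w\<in>A. Poly_Mapping.lookup p w * act_word w F c)"
  unfolding act_alg_def
  by (rule sum.mono_neutral_left) (use assms in \<open>auto simp: in_keys_iff\<close>)

lemma act_alg_add: "act_alg (p + q) F c = act_alg p F c + act_alg q F c"
proof -
  let ?A = "Poly_Mapping.keys p \<union> Poly_Mapping.keys q"
  show ?thesis
    using keys_add[of p q]
    by (simp add: act_alg_superset[of ?A] lookup_add distrib_right sum.distrib)
qed

lemma act_alg_single: "act_alg (Poly_Mapping.single w a) F c = a * act_word w F c"
  by (simp add: act_alg_def)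

lemma act_alg_fword: "act_alg (fword w) F = act_word w F"
  by (simp add: fword_def act_alg_single fun_eq_iff)

lemma act_alg_0: "act_alg 0 F c = 0"
  by (simp add: act_alg_def)

lemma act_alg_fconst_mult: "act_alg (fconst a * p) F c = a * act_alg p F c"
  by (induction p rule: single_induct)
    (simp_all add: act_alg_0 distrib_left act_alg_add fconst_def mult_single plus_list_def act_alg_single)

lemma act_alg_uminus: "act_alg (- p) F c = - act_alg p F c"
  using act_alg_fconst_mult[of "- 1" p F c] by (simp add: fconst_uminus)

lemma act_alg_diff: "act_alg (p - q) F c = act_alg p F c - act_alg q F c"
  using act_alg_add[of p "- q" F c] by (simp add: act_alg_uminus)

lemma act_word_act_alg: "act_word w (act_alg p F) = act_alg (p * fword w) F"
proof (induction p rule: single_induct)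
  case zero
  have "act_alg 0 F = (\<lambda>_. 0)" by (simp add: act_alg_0 fun_eq_iff)
  then show ?case by (simp add: act_word_zero)
next
  case (add k c p)
  have "act_alg (Poly_Mapping.single k c + p) F = (\<lambda>d. c * act_word k F d + act_alg p F d)"
    by (simp add: fun_eq_iff act_alg_add act_alg_single)
  then show ?case
    by (simp add: act_word_add act_word_scale add distrib_right fun_eq_iff act_alg_add
        fword_def mult_single plus_list_def act_alg_single)
qed

lemma act_alg_mult: "act_alg (p * q) F = act_alg q (act_alg p F)"
proof (induction q rule: single_induct)
  case (add k c q)
  have "p * Poly_Mapping.single k c = fconst c * (p * fword k)"
    by (metis fconst_commute mult.assoc single_eq_fconst_fword)
  then show ?case
    using add by (simp add: distrib_left fun_eq_iff act_alg_add act_alg_single act_alg_fconst_mult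
        flip: act_word_act_alg)
qed (simp add: act_alg_0 fun_eq_iff)

lemma act_alg_srel: "act_alg (srel x y) F = (\<lambda>_. 0)"
proof
  fix c
  show "act_alg (srel x y) F c = 0"
    using act_bracket[of y x F c]
    by (simp add: srel_def Let_def fmul_eq_times gen_def act_alg_diff act_alg_fconst_mult act_alg_0
        act_alg_fword del: fconst_neg_one_power flip: fword_append)
qed

lemma act_alg_Kid: "p \<in> Kid \<Longrightarrow> act_alg p F c = 0"
proof (induction rule: Kid.induct)
  case (Kid_gen u x y v)
  have "act_alg (u * srel x y * v) F = act_alg v (\<lambda>_. 0)"
    by (simp add: act_alg_mult act_alg_srel)
  then show ?case by (simp add: fmul_eq_times act_alg_def act_word_zero)
qed (simp_all add: act_alg_0 act_alg_add)

text \<open>A letter replaces a single entry \<open>Some b\<close>. The multiset equation records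
  this without the position, which is all that the counting of symbols needs.\<close>

lemma act_eq_0I:
  assumes "Some b \<in> set c \<Longrightarrow> (\<forall>z. (z = Some a \<or> z = None \<and> is_proper a) \<longrightarrow>
      (\<forall>c'. add_mset (Some b) (mset c') = add_mset z (mset c) \<longrightarrow> F c' = 0))"
  shows "act (a, b) F c = 0"
  using assms
proof (induction c arbitrary: F)
  case (Cons d cs)
  have *: "act (a, b) (\<lambda>cs. F (d # cs)) cs = 0"
  proof (rule Cons.IH, intro allI impI)
    fix z c' assume "Some b \<in> set cs" "z = Some a \<or> z = None \<and> is_proper a"
      "add_mset (Some b) (mset c') = add_mset z (mset cs)"
    then show "F (d # c') = 0"
      using Cons.prems by (auto simp: add_mset_commute)
  qed
  have "subst a (\<lambda>z. F (z # cs)) = 0" if "d = Some b"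
    using Cons.prems that by (auto simp: subst_def add_mset_commute)
  with * show ?case by simp
qed simp

text \<open>Counting a virtual symbol: letter by letter, its multiplicity in the list grows when it is
  created and drops when it is annihilated, so an irregular word annihilates lists free of it.\<close>
lemma act_word_irregular_aux:
  assumes "i < length v" "is_virtual \<gamma>"
    and "count (mset c) (Some \<gamma>) + card {j. j < i \<and> fst (v ! j) = \<gamma>} < card {j. j \<le> i \<and> snd (v ! j) = \<gamma>}"
  shows "foldr act v F c = 0"
  using assms
proof (induction v arbitrary: i c)
  case (Cons x v)
  obtain a b where x: "x = (a, b)" by (cases x)
  have split0: "{j. j < Suc k \<and> P ((x # v) ! j)} = (if P x then {0} else {}) \<union> Suc ` {j. j < k \<and> P (v ! j)}" for k P
    by (auto simp: less_Suc_eq_0_disj image_iff)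
  have split: "card {j. j < Suc k \<and> P ((x # v) ! j)} = (if P x then 1 else 0) + card {j. j < k \<and> P (v ! j)}" for k P
    unfolding split0 by (subst card_Un_disjoint) (auto simp: card_image)
  show ?case
  proof (cases i)
    case 0
    then have "b = \<gamma> \<and> count (mset c) (Some \<gamma>) = 0"
      using Cons.prems(3) split[of 0 "\<lambda>x. snd x = \<gamma>"] by (auto simp: x less_Suc_eq_le split: if_splits)
    then have "Some b \<notin> set c" by (auto simp: count_eq_zero_iff)
    then show ?thesis unfolding foldr.simps o_apply x by (intro act_eq_0I) auto
  next
    case (Suc i')
    have k: "count (mset c) (Some \<gamma>) + (if a = \<gamma> then 1 else 0) + card {j. j < i' \<and> fst (v ! j) = \<gamma>}
        < (if b = \<gamma> then 1 else 0) + card {j. j \<le> i' \<and> snd (v ! j) = \<gamma>}"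
      using Cons.prems(3) split[of i' "\<lambda>x. fst x = \<gamma>"] split[of "Suc i'" "\<lambda>x. snd x = \<gamma>"]
      by (simp add: Suc x less_Suc_eq_le)
    have "foldr act v F c' = 0"
      if z: "z = Some a \<or> z = None \<and> is_proper a"
        and m: "add_mset (Some b) (mset c') = add_mset z (mset c)" for z c'
    proof (rule Cons.IH)
      have "count (mset c') (Some \<gamma>) + (if b = \<gamma> then 1 else 0) = count (mset c) (Some \<gamma>) + (if z = Some \<gamma> then 1 else 0)"
        using arg_cong[OF m, of "\<lambda>M. count M (Some \<gamma>)"] by (simp split: if_splits)
      then show "count (mset c') (Some \<gamma>) + card {j. j < i' \<and> fst (v ! j) = \<gamma>}
          < card {j. j \<le> i' \<and> snd (v ! j) = \<gamma>}"
        using k z by (auto split: if_splits)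
    qed (use Cons.prems Suc in auto)
    then show ?thesis unfolding foldr.simps o_apply x by (intro act_eq_0I) auto
  qed
qed simp

lemma act_word_irregular:
  assumes "irregular w" and "\<And>\<gamma>. Some \<gamma> \<in> set c \<Longrightarrow> is_proper \<gamma>"
  shows "act_word w F c = 0"
proof -
  obtain i \<gamma> where i: "i < length (rev w)" "is_virtual \<gamma>"
     "card {j. j < i \<and> fst (rev w ! j) = \<gamma>} < card {j. j \<le> i \<and> snd (rev w ! j) = \<gamma>}"
    using assms(1) unfolding irregular_def Let_def by blast
  have "Some \<gamma> \<notin> set c" using assms(2)[of \<gamma>] i(2) by (cases \<gamma>) auto
  then have "count (mset c) (Some \<gamma>) = 0" by (simp add: count_eq_zero_iff)
  then have "foldr act (rev w) F c = 0"
    by (intro act_word_irregular_aux[OF i(1,2)]) (use i(3) in linarith)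
  then show ?thesis by (simp add: foldr_conv_fold)
qed

lemma act_alg_IrrF:
  assumes "p \<in> IrrF" and "\<And>\<gamma>. Some \<gamma> \<in> set c \<Longrightarrow> is_proper \<gamma>"
  shows "act_alg p F c = 0"
  using assms
proof (induction rule: IrrF.induct)
  case (IrrF_gen w u)
  then show ?case
    by (simp add: fmul_eq_times act_alg_mult act_alg_fword act_word_irregular)
qed (simp_all add: act_alg_Kid act_alg_add)

section \<open>Faithfulness of the action\<close>

text \<open>Rearrangements are composed of exchanges of neighbours. This serves for the letters of a
  word and again for the rows of a one-column tableau.\<close>

lemma mset_eq_swap_induct [consumes 1, case_names refl trans swap]:
  assumes "mset w = mset w'"
    and refl: "\<And>w. R w w"
    and trans: "\<And>a b c. R a b \<Longrightarrow> R b c \<Longrightarrow> R a c"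
    and swap: "\<And>u x y v. R (u @ x # y # v) (u @ y # x # v)"
  shows "R w w'"
proof -
  have front: "R (u @ l @ x # v) (u @ x # l @ v)" for u l x v
  proof (induction l arbitrary: v rule: rev_induct)
    case (snoc y l)
    have "R (u @ l @ y # x # v) (u @ l @ x # y # v)" using swap[of "u @ l"] by simp
    then show ?case using trans snoc[of "y # v"] by fastforce
  qed (simp add: refl)
  have "R (u @ w) (u @ w')" for u
    using assms(1)
  proof (induction w' arbitrary: u w)
    case (Cons x w')
    then obtain l v where w: "w = l @ x # v"
      by (metis list.set_intros(1) set_mset_mset split_list)
    have "R (u @ x # l @ v) (u @ x # w')"
      using Cons.IH[of "l @ v" "u @ [x]"] Cons.prems by (simp add: w)
    then show ?case using front[of u l x v] by (auto intro: trans simp: w)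
  qed (simp add: refl)
  from this[of "[]"] show ?thesis by simp
qed

section \<open>Ordered words span \<open>U(gl(n))\<close>\<close>

definition proper_word :: "'l letter list \<Rightarrow> bool" where
  "proper_word w \<longleftrightarrow> (\<forall>x\<in>set w. is_proper (fst x) \<and> is_proper (snd x))"

lemma in_Ugln_iff: "in_Ugln u \<longleftrightarrow> (\<forall>w\<in>Poly_Mapping.keys u. proper_word w)"
  by (simp add: in_Ugln_def proper_word_def)

lemma in_Ugln_fword: "proper_word w \<Longrightarrow> in_Ugln (fword w)"
  by (simp add: in_Ugln_iff fword_def)

lemma spar_proper: "is_proper a \<Longrightarrow> spar a = 1"
  by (cases a) auto

lemma lpar_proper: "is_proper a \<Longrightarrow> is_proper b \<Longrightarrow> lpar (a, b) = 0"
  by (simp add: lpar_def spar_proper)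

definition canon :: "'a multiset \<Rightarrow> 'a list" where
  "canon M = (SOME w. mset w = M)"

lemma mset_canon [simp]: "mset (canon M) = M"
  unfolding canon_def by (rule someI_ex) (rule ex_mset)

text \<open>The spanning half of the Poincare-Birkhoff-Witt theorem for \<open>gl(n)\<close>: one ordering of
  every multiset of letters suffices.\<close>
definition normalizable :: "'l falg \<Rightarrow> bool" where
  "normalizable p \<longleftrightarrow> (\<exists>q. p - q \<in> Kid \<and> in_Ugln q \<and> Poly_Mapping.keys q \<subseteq> range canon)"

lemma normalizable_0: "normalizable 0"
  unfolding normalizable_def by (intro exI[of _ 0]) (simp add: Kid_zero in_Ugln_0)

lemma normalizable_add:
  assumes "normalizable p" "normalizable q" shows "normalizable (p + q)"
proof -
  obtain p' q' where *: "p - p' \<in> Kid" "in_Ugln p'" "Poly_Mapping.keys p' \<subseteq> range canon"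
    "q - q' \<in> Kid" "in_Ugln q'" "Poly_Mapping.keys q' \<subseteq> range canon"
    using assms unfolding normalizable_def by blast
  then show ?thesis unfolding normalizable_def
    using Kid_add[of "p - p'" "q - q'"] keys_add[of p' q'] in_Ugln_add[of p' q']
    by (intro exI[of _ "p' + q'"]) (auto simp: algebra_simps)
qed

lemma normalizable_fconst_mult:
  assumes "normalizable p" shows "normalizable (fconst c * p)"
proof -
  obtain q where *: "p - q \<in> Kid" "in_Ugln q" "Poly_Mapping.keys q \<subseteq> range canon"
    using assms unfolding normalizable_def by blast
  then show ?thesis unfolding normalizable_def
    using Kid_mult_left[of "p - q" "fconst c"] in_Ugln_fconst_mult[of q c]
    by (intro exI[of _ "fconst c * q"]) (auto simp: right_diff_distrib in_keys_iff lookup_fconst_mult)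
qed

lemma normalizable_uminus: "normalizable p \<Longrightarrow> normalizable (- p)"
  using normalizable_fconst_mult[of p "- 1"] by (simp add: fconst_uminus)

lemma normalizable_Kid: "p - q \<in> Kid \<Longrightarrow> normalizable q \<Longrightarrow> normalizable p"
  unfolding normalizable_def using Kid_add by fastforce

lemma normalizable_fword: "proper_word w \<Longrightarrow> normalizable (fword w)"
proof (induction "length w" arbitrary: w rule: less_induct)
  case less
  have "mset w = mset (canon (mset w))" by simp
  \<comment> \<open>The guard \<open>mset a = mset w\<close> restricts the exchanges to
    rearrangements of \<open>w\<close>: only for these are the letters known to be proper and the
    brackets short enough for the outer induction.\<close>
  then have "mset w = mset (canon (mset w)) \<and> (mset w = mset w \<longrightarrow> normalizable (fword w - fword (canon (mset w))))"
  proof (induction rule: mset_eq_swap_induct[where R = "\<lambda>a b. mset a = mset b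
        \<and> (mset a = mset w \<longrightarrow> normalizable (fword a - fword b))"])
    case (trans a b c)
    then show ?case
      using normalizable_add[of "fword a - fword b" "fword b - fword c"] by auto
  next
    case (swap u x y v)
    obtain a b p q where xy: "x = (a, b)" "y = (p, q)" by (cases x; cases y) auto
    have "normalizable (fword (u @ x # y # v) - fword (u @ y # x # v))"
      if m: "mset (u @ x # y # v) = mset w"
    proof -
      have set: "set w = set (u @ x # y # v)" and len: "length w = length (u @ x # y # v)"
        using m by (metis set_mset_mset, metis size_mset)
      have pr: "is_proper a" "is_proper b" "is_proper p" "is_proper q" "proper_word u" "proper_word v"
        using less.prems set unfolding proper_word_def xy by auto
      have n: "normalizable (fword (u @ (a, q) # v))" "normalizable (fword (u @ (p, b) # v))"
        by (rule less.hyps; use pr len in \<open>simp add: proper_word_def ball_Un\<close>)+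
      let ?r = "(if b = p then fword (u @ (a, q) # v) else 0) + - (if a = q then fword (u @ (p, b) # v) else 0)"
      have "normalizable ?r"
        by (intro normalizable_add normalizable_uminus) (use n in \<open>auto simp: normalizable_0\<close>)
      moreover have "fword (u @ x # y # v) - fword (u @ y # x # v) - ?r \<in> Kid"
        using fword_swap[of u a b p q v] pr by (simp add: xy lpar_proper algebra_simps)
      ultimately show ?thesis by (rule normalizable_Kid[rotated])
    qed
    then show ?case by simp
  qed (simp add: normalizable_0)
  moreover have "proper_word (canon (mset w))"
    using less.prems unfolding proper_word_def by (metis mset_canon set_mset_mset)
  then have "normalizable (fword (canon (mset w)))"
    unfolding normalizable_def
    by (intro exI[of _ "fword (canon (mset w))"]) (auto simp: Kid_zero in_Ugln_iff fword_def)
  ultimately show ?case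
    using normalizable_add by fastforce
qed

lemma normalizable_Ugln:
  assumes "in_Ugln p" shows "normalizable p"
proof -
  have "normalizable (\<Sum>w\<in>A. Poly_Mapping.single w (Poly_Mapping.lookup p w))"
    if "finite A" "A \<subseteq> Poly_Mapping.keys p" for A
    using that assms
    by (induction A rule: finite_induct)
      (auto simp: normalizable_0 single_eq_fconst_fword in_Ugln_iff
        intro!: normalizable_add normalizable_fconst_mult normalizable_fword)
  from this[of "Poly_Mapping.keys p"] show ?thesis by (simp flip: poly_mapping_eq_sum_single)
qed

section \<open>Product forms that separate words\<close>

fun tens :: "('a \<Rightarrow> complex) list \<Rightarrow> 'a list \<Rightarrow> complex" where
  "tens [] [] = 1"
| "tens (f # fs) (c # cs) = f c * tens fs cs"
| "tens _ _ = 0"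

lemma tens_eq_prod:
  "length fs = length c \<Longrightarrow> tens fs c = (\<Prod>k<length fs. (fs ! k) (c ! k))"
proof (induction fs arbitrary: c)
  case (Cons f fs)
  then obtain d cs where "c = d # cs" by (cases c) auto
  with Cons show ?case by (simp add: prod.lessThan_Suc_shift del: prod.lessThan_Suc)
qed simp

definition act1 :: "'l letter \<Rightarrow> ('l sym option \<Rightarrow> complex) \<Rightarrow> 'l sym option \<Rightarrow> complex" where
  "act1 x f c = (if c = Some (snd x) then subst (fst x) f else 0)"

text \<open>Proper letters are even, so no signs arise and a letter acts on a product form as a
  derivation.\<close>

lemma act_tens:
  assumes "is_proper (fst x)" "is_proper (snd x)"
  shows "act x (tens fs) c = (\<Sum>k<length fs. tens (fs[k := act1 x (fs ! k)]) c)"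
proof (induction fs arbitrary: c)
  case Nil
  then show ?case by (cases c) (simp_all add: subst_def act_zero)
next
  case (Cons f fs)
  have "lpar x = 0" using assms lpar_proper[of "fst x" "snd x"] by simp
  moreover have "subst (fst x) (\<lambda>z. f z * t) = act1 x f (Some (snd x)) * t"
    "d \<noteq> Some (snd x) \<Longrightarrow> act1 x f d = 0" for d t
    by (simp_all add: subst_def act1_def algebra_simps)
  ultimately show ?case
    by (cases c) (simp_all add: sum.lessThan_Suc_shift act_scale Cons.IH sum_distrib_left
        del: sum.lessThan_Suc)
qed

lemma act_word_Cons_tens:
  assumes "is_proper (fst x)" "is_proper (snd x)"
  shows "act_word (x # w) (tens fs) c = (\<Sum>k<length fs. act_word w (tens (fs[k := act1 x (fs ! k)])) c)"
proof -
  have "act x (tens fs) = (\<lambda>c. \<Sum>k<length fs. tens (fs[k := act1 x (fs ! k)]) c)"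
    using act_tens[OF assms] by blast
  then show ?thesis by (simp add: act_word_sum)
qed

text \<open>Each letter changes one factor, so a word with fewer letters than there are vanishing
  factors leaves one of them vanishing.\<close>

lemma act_word_tens_eq_0:
  assumes "proper_word w" "length fs = length c" "Z \<subseteq> {..<length fs}"
    and "\<And>k. k \<in> Z \<Longrightarrow> (fs ! k) (c ! k) = 0" and "length w < card Z"
  shows "act_word w (tens fs) c = 0"
  using assms
proof (induction w arbitrary: fs Z)
  case Nil
  then obtain k where "k \<in> Z" by fastforce
  with Nil show ?case by (auto simp: tens_eq_prod intro!: bexI[of _ k])
next
  case (Cons x w)
  have "act_word w (tens (fs[k := act1 x (fs ! k)])) c = 0" for k
  proof (rule Cons.IH[where Z = "Z - {k}"])
    have "finite Z" using Cons.prems(3) finite_subset by blast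
    then show "length w < card (Z - {k})"
      using Cons.prems(5) by (simp add: card_Diff_singleton_if) linarith
  qed (use Cons.prems in \<open>auto simp: proper_word_def nth_list_update\<close>)
  then show ?case
    using Cons.prems(1) by (subst act_word_Cons_tens) (auto simp: proper_word_def)
qed

text \<open>The form belonging to \<open>(i, j)\<close> vanishes at \<open>Some j\<close>, but composed with a letter it is
  nonzero there exactly for the letter \<open>(i, j)\<close>.  Hence a product of such forms kills every word
  that leaves one of its factors untouched.\<close>
fun coform :: "'l letter \<Rightarrow> 'l sym option \<Rightarrow> complex" where
  "coform (i, j) None = of_bool (i = j)"
| "coform (i, j) (Some a) = of_bool (a = i) - of_bool (i = j)"

lemma act1_coform:
  "is_proper (fst x) \<Longrightarrow> act1 x (coform y) (Some (snd y)) = of_bool (x = y)"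
  by (cases x; cases y) (auto simp: act1_def subst_def)

text \<open>\<open>R\<close> collects the positions whose form is still untouched; a form already
  composed with its own letter has value 1. The result counts the matchings of the letters of
  \<open>w\<close> with the positions in \<open>R\<close>. Being a natural number, it rules out
  cancellation.\<close>

lemma act_word_coform:
  assumes "proper_word w" "length fs = length w0" "R \<subseteq> {..<length w0}"
    and "\<And>k. k \<in> R \<Longrightarrow> fs ! k = coform (w0 ! k)"
    and "\<And>k. k < length w0 \<Longrightarrow> k \<notin> R \<Longrightarrow> (fs ! k) (Some (snd (w0 ! k))) = 1"
    and "length w = card R"
  shows "\<exists>n::nat. act_word w (tens fs) (map (\<lambda>x. Some (snd x)) w0) = of_nat n
     \<and> (n > 0 \<longleftrightarrow> mset w = image_mset ((!) w0) (mset_set R))"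
  using assms
proof (induction w arbitrary: fs R)
  case Nil
  have "finite R" using Nil.prems(3) finite_subset by blast
  then have "R = {}" using Nil by simp
  then show ?case using Nil by (intro exI[of _ 1]) (simp add: tens_eq_prod)
next
  case (Cons x w)
  let ?c = "map (\<lambda>x. Some (snd x)) w0" and ?fs = "\<lambda>k. fs[k := act1 x (fs ! k)]"
  have fin: "finite R" using Cons.prems(3) finite_subset by blast
  have px: "is_proper (fst x)" "is_proper (snd x)" "proper_word w"
    using Cons.prems(1) by (auto simp: proper_word_def)
  have zero: "(fs ! k) (?c ! k) = 0" if "k \<in> R" for k
    using that Cons.prems(3,4) by (cases "w0 ! k") auto
  \<comment> \<open>A letter spent outside \<open>R\<close>, or on a position of \<open>R\<close>
    belonging to another letter, leaves all forms in \<open>R\<close> vanishing, while one letter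
    too few remains.\<close>
  have out: "act_word w (tens (?fs k)) ?c = 0" if "k < length w0" "k \<notin> R \<or> w0 ! k \<noteq> x" for k
  proof (rule act_word_tens_eq_0[where Z = R])
    fix j assume j: "j \<in> R"
    then have lt: "j < length w0" using Cons.prems(3) by auto
    show "(?fs k ! j) (?c ! j) = 0"
      using that(2) zero[OF j] act1_coform[OF px(1), of "w0 ! k"] Cons.prems(2,4) j lt that(1)
      by (cases "j = k") auto
  qed (use px Cons.prems in auto)
  have "\<exists>n::nat. act_word w (tens (?fs k)) ?c = of_nat n
     \<and> (n > 0 \<longleftrightarrow> mset w = image_mset ((!) w0) (mset_set (R - {k})))" if k: "k \<in> R" "w0 ! k = x" for k
  proof (rule Cons.IH)
    show "length w = card (R - {k})" using Cons.prems(6) k fin by simp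
    fix j assume j: "j < length w0" "j \<notin> R - {k}"
    show "(?fs k ! j) (Some (snd (w0 ! j))) = 1"
      using Cons.prems(2,4,5) j k act1_coform[OF px(1), of "w0 ! k"] by (cases "j = k") auto
  qed (use px k Cons.prems in auto)
  then have "\<forall>k\<in>{k\<in>R. w0 ! k = x}. \<exists>n::nat. act_word w (tens (?fs k)) ?c = of_nat n
     \<and> (n > 0 \<longleftrightarrow> mset w = image_mset ((!) w0) (mset_set (R - {k})))" by blast
  from bchoice[OF this] obtain n :: "nat \<Rightarrow> nat" where
    n: "\<forall>k\<in>{k\<in>R. w0 ! k = x}. act_word w (tens (?fs k)) ?c = of_nat (n k)
     \<and> (n k > 0 \<longleftrightarrow> mset w = image_mset ((!) w0) (mset_set (R - {k})))" ..
  let ?K = "{k\<in>R. w0 ! k = x}"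
  have "act_word (x # w) (tens fs) ?c = (\<Sum>k<length w0. act_word w (tens (?fs k)) ?c)"
    using act_word_Cons_tens[OF px(1,2), of w fs ?c] Cons.prems(2) by simp
  also have "\<dots> = (\<Sum>k\<in>?K. act_word w (tens (?fs k)) ?c)"
    by (rule sum.mono_neutral_right) (use Cons.prems(3) out in auto)
  also have "\<dots> = of_nat (\<Sum>k\<in>?K. n k)" using n by simp
  finally have val: "act_word (x # w) (tens fs) ?c = of_nat (\<Sum>k\<in>?K. n k)" .
  have R: "mset_set R = add_mset k (mset_set (R - {k}))" if "k \<in> R" for k
    using fin that by (rule mset_set.remove)
  have "(\<Sum>k\<in>?K. n k) = 0 \<longleftrightarrow> (\<forall>k\<in>?K. n k = 0)"
    by (rule sum_eq_0_iff) (use fin in simp)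
  then have "(\<Sum>k\<in>?K. n k) > 0 \<longleftrightarrow> (\<exists>k\<in>?K. n k > 0)"
    unfolding zero_less_iff_neq_zero by (simp del: neq0_conv)
  also have "\<dots> \<longleftrightarrow> (\<exists>k\<in>?K. mset w = image_mset ((!) w0) (mset_set (R - {k})))" using n by blast
  also have "\<dots> \<longleftrightarrow> mset (x # w) = image_mset ((!) w0) (mset_set R)"
  proof
    assume eq: "mset (x # w) = image_mset ((!) w0) (mset_set R)"
    then have "x \<in># image_mset ((!) w0) (mset_set R)" by (metis list.set_intros(1) set_mset_mset)
    then obtain k where k: "k \<in> ?K" using fin by auto
    then show "\<exists>k\<in>?K. mset w = image_mset ((!) w0) (mset_set (R - {k}))"
      using eq R[of k] by (intro bexI[of _ k]) auto
  qed (use R in auto)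
  finally have "(\<Sum>k\<in>?K. n k) > 0 \<longleftrightarrow> mset (x # w) = image_mset ((!) w0) (mset_set R)" .
  with val show ?case by (intro exI[of _ "\<Sum>k\<in>?K. n k"] conjI)
qed

text \<open>A longest word \<open>w0\<close> of the support supplies both the form and the tensor.
  Shorter words leave a factor untouched, and words of the same length contribute only if they have
  the letters of \<open>w0\<close>, which the canonical ordering excludes for any other word. So the
  coefficient of \<open>w0\<close> would vanish.\<close>

lemma normal_form_eq_0:
  assumes "in_Ugln q" "Poly_Mapping.keys q \<subseteq> range canon"
    and zero: "\<And>F c. (\<And>\<gamma>. Some \<gamma> \<in> set c \<Longrightarrow> is_proper \<gamma>) \<Longrightarrow> act_alg q F c = 0"
  shows "q = 0"
proof (rule ccontr)
  assume "q \<noteq> 0"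
  then have ne: "Poly_Mapping.keys q \<noteq> {}" by simp
  let ?m = "Max (length ` Poly_Mapping.keys q)"
  have "?m \<in> length ` Poly_Mapping.keys q" using ne by (intro Max_in) auto
  then obtain w0 where w0: "w0 \<in> Poly_Mapping.keys q" "length w0 = ?m" by auto
  have max: "length w \<le> length w0" if "w \<in> Poly_Mapping.keys q" for w
    using that by (simp add: w0(2))
  let ?F = "tens (map coform w0)" and ?c = "map (\<lambda>x. Some (snd x)) w0"
  have zs: "coform (w0 ! k) (Some (snd (w0 ! k))) = 0" for k by (cases "w0 ! k") auto
  have ex: "\<exists>n::nat. act_word w ?F ?c = of_nat n \<and> (n > 0 \<longleftrightarrow> mset w = mset w0)"
    if "w \<in> Poly_Mapping.keys q" "length w = length w0" for w
  proof -
    have "image_mset ((!) w0) (mset_set {..<length w0}) = mset w0"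
      by (metis map_nth mset_map mset_upt lessThan_atLeast0)
    then show ?thesis
      using act_word_coform[of w "map coform w0" w0 "{..<length w0}"] that assms(1)
      by (auto simp: in_Ugln_iff)
  qed
  have "act_word w ?F ?c = 0" if w: "w \<in> Poly_Mapping.keys q" "w \<noteq> w0" for w
  proof (cases "length w = length w0")
    case True
    have "mset w \<noteq> mset w0"
      using w w0(1) assms(2) by (metis imageE mset_canon subsetD)
    then show ?thesis using ex[OF w(1) True] by auto
  next
    case False
    then have "length w < length w0" using max[OF w(1)] by simp
    then show ?thesis
      using act_word_tens_eq_0[of w "map coform w0" ?c "{..<length w0}"] w assms(1) zs
      by (auto simp: in_Ugln_iff)
  qed
  then have "act_alg q ?F ?c = Poly_Mapping.lookup q w0 * act_word w0 ?F ?c"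
    unfolding act_alg_def by (subst sum.remove[OF _ w0(1)]) auto
  moreover have "act_alg q ?F ?c = 0"
    by (rule zero) (use w0(1) assms(1) in \<open>auto simp: in_Ugln_iff proper_word_def\<close>)
  moreover have "act_word w0 ?F ?c \<noteq> 0" using ex[OF w0(1) HOL.refl] by auto
  ultimately show False using w0(1) by (simp add: in_keys_iff)
qed

text \<open>A normal form of \<open>u\<close> acts on the tensors without virtual entries as
  \<open>u\<close> does, that is, by 0. This is the directness of the sum of \<open>U(gl(n))\<close>
  and \<open>Irr\<close>, and it determines a Capelli bitableau modulo \<open>Kid\<close>.\<close>

lemma Ugln_Int_IrrF:
  assumes "in_Ugln u" "u \<in> IrrF" shows "u \<in> Kid"
proof -
  obtain q where q: "u - q \<in> Kid" "in_Ugln q" "Poly_Mapping.keys q \<subseteq> range canon"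
    using normalizable_Ugln[OF assms(1)] unfolding normalizable_def by blast
  have "q = 0"
  proof (rule normal_form_eq_0[OF q(2,3)])
    fix F and c :: "'a sym option list" assume c: "\<And>\<gamma>. Some \<gamma> \<in> set c \<Longrightarrow> is_proper \<gamma>"
    show "act_alg q F c = 0"
      using act_alg_IrrF[OF assms(2) c, where F = F] act_alg_Kid[OF q(1), where F = F and c = c] by (simp add: act_alg_diff)
  qed
  with q(1) show ?thesis by simp
qed

section \<open>Devirtualization\<close>

lemma irregularI:
  assumes "is_virtual b" "b \<notin> fst ` set v"
  shows "irregular (u @ (a, b) # v)"
proof -
  let ?w = "u @ (a, b) # v"
  have nth: "rev ?w ! j = (if j = length v then (a, b) else rev v ! j)" if "j \<le> length v" for j
    using that by (auto simp: nth_append)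
  have "fst (rev v ! j) \<noteq> b" if "j < length v" for j
    using assms(2) that by (metis image_eqI length_rev nth_mem set_rev)
  then have "{j. j < length v \<and> fst (rev ?w ! j) = b} = {}" using nth by auto
  then have c0: "card {j. j < length v \<and> fst (rev ?w ! j) = b} = 0" by (simp only: card.empty)
  have "length v \<in> {j. j \<le> length v \<and> snd (rev ?w ! j) = b}"
    using nth[of "length v"] by simp
  then have c1: "card {j. j \<le> length v \<and> snd (rev ?w ! j) = b} > 0"
    by (subst card_gt_0_iff) auto
  have "length v < length (rev ?w)" by simp
  moreover have "card {j. j < length v \<and> fst (rev ?w ! j) = b} < card {j. j \<le> length v \<and> snd (rev ?w ! j) = b}"
    using c0 c1 by linarith
  ultimately show ?thesis
    unfolding irregular_def Let_def using assms(1) by blast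
qed

definition devirtualizable :: "'l falg \<Rightarrow> bool" where
  "devirtualizable p \<longleftrightarrow> (\<exists>u. in_Ugln u \<and> p - u \<in> IrrF)"

lemma devirtualizable_add:
  assumes "devirtualizable p" "devirtualizable q" shows "devirtualizable (p + q)"
proof -
  obtain u v where *: "in_Ugln u" "p - u \<in> IrrF" "in_Ugln v" "q - v \<in> IrrF"
    using assms unfolding devirtualizable_def by blast
  then show ?thesis unfolding devirtualizable_def
    using IrrF_add[of "p - u" "q - v"] in_Ugln_add[of u v]
    by (intro exI[of _ "u + v"]) (auto simp: algebra_simps)
qed

lemma devirtualizable_fconst_mult:
  assumes "devirtualizable p" shows "devirtualizable (fconst c * p)"
proof -
  obtain u where *: "in_Ugln u" "p - u \<in> IrrF"
    using assms unfolding devirtualizable_def by blast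
  then show ?thesis unfolding devirtualizable_def
    using IrrF_mult_left[of "p - u" "fconst c"] in_Ugln_fconst_mult[of u c]
    by (intro exI[of _ "fconst c * u"]) (auto simp: right_diff_distrib)
qed

lemma devirtualizable_IrrF: "p - q \<in> IrrF \<Longrightarrow> devirtualizable q \<Longrightarrow> devirtualizable p"
  unfolding devirtualizable_def using IrrF_trans by blast

lemma devirtualizable_0: "devirtualizable 0"
  unfolding devirtualizable_def by (intro exI[of _ 0]) (simp add: in_Ugln_0 IrrF_zero)

text \<open>Each virtual symbol is created as often as it is annihilated. Exchanging letters
  preserves this, and so does a bracket, which drops one symbol from both sides.\<close>

definition balanced :: "'l letter list \<Rightarrow> bool" where
  "balanced w \<longleftrightarrow> filter_mset is_virtual (mset (map fst w)) = filter_mset is_virtual (mset (map snd w))"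

lemma is_virtual_iff: "is_virtual a \<longleftrightarrow> \<not> is_proper a"
  by (cases a) auto

text \<open>A letter annihilating a virtual symbol can be moved to the far right, where it makes the word
  irregular; the brackets met on the way are shorter balanced words.\<close>
lemma balanced_devirtualizable: "balanced w \<Longrightarrow> devirtualizable (fword w)"
proof (induction "length w" arbitrary: w rule: less_induct)
  case less
  show ?case
  proof (cases "\<exists>x\<in>set w. is_virtual (snd x)")
    case False
    then have "filter_mset is_virtual (mset (map snd w)) = {#}" by (auto simp: filter_mset_eq_conv)
    then have "filter_mset is_virtual (mset (map fst w)) = {#}" using less.prems by (simp add: balanced_def)
    then have "set_mset (filter_mset is_virtual (mset (map fst w))) = {}" by (simp only: set_mset_empty)
    then have "\<forall>x\<in>set w. \<not> is_virtual (fst x)" by auto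
    then have "proper_word w" using False by (auto simp: proper_word_def is_virtual_iff)
    then show ?thesis unfolding devirtualizable_def
      by (intro exI[of _ "fword w"]) (simp add: in_Ugln_fword IrrF_zero)
  next
    case True
    then obtain a b u v where w: "w = u @ (a, b) # v" and b: "is_virtual b"
      by (metis prod.collapse split_list)
    have "devirtualizable (fword (u @ (a, b) # v))"
      if "length (u @ (a, b) # v) = length w" "balanced (u @ (a, b) # v)" for u
      using that
    proof (induction v arbitrary: u)
      case Nil
      then show ?case
        using devirtualizable_IrrF[OF _ devirtualizable_0] irregular_in_IrrF irregularI[OF b, of "[]" u a]
        by fastforce
    next
      case (Cons y v)
      obtain p q where y: "y = (p, q)" by (cases y)
      have "devirtualizable (fword ((u @ [y]) @ (a, b) # v))"
        by (rule Cons.IH) (use Cons.prems in \<open>auto simp: balanced_def add_mset_commute split: if_splits\<close>)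
      moreover have "devirtualizable (if b = p then fword (u @ (a, q) # v) else 0)"
        using Cons.prems
        by (auto intro!: devirtualizable_0 less.hyps simp: y balanced_def add_mset_commute split: if_splits)
      moreover have "devirtualizable (if a = q then fword (u @ (p, b) # v) else 0)"
        using Cons.prems
        by (auto intro!: devirtualizable_0 less.hyps simp: y balanced_def add_mset_commute split: if_splits)
      ultimately have "devirtualizable (fconst ((- 1) ^ (lpar (a, b) * lpar (p, q))) * fword (u @ (p, q) # (a, b) # v)
        + (if b = p then fword (u @ (a, q) # v) else 0)
        + fconst (- ((- 1) ^ (lpar (a, b) * lpar (p, q)))) * (if a = q then fword (u @ (p, b) # v) else 0))"
        by (intro devirtualizable_add devirtualizable_fconst_mult) (auto simp: y)
      then show ?case
        unfolding y
        by (rule devirtualizable_IrrF[OF IrrF_K, rotated])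
          (use fword_swap[of u a b p q v] in \<open>simp only: fconst_uminus mult_minus_left add_uminus_conv_diff\<close>)
    qed
    then show ?thesis using less.prems w by blast
  qed
qed

section \<open>Virtual words and their polarizations\<close>

definition xword :: "('l \<times> nat) list \<Rightarrow> 'l letter list" where
  "xword X = map (\<lambda>(s, c). (Prop s, Alpha c)) X"

definition yword :: "('l \<times> nat) list \<Rightarrow> 'l letter list" where
  "yword Y = map (\<lambda>(t, c). (Alpha c, Prop t)) Y"

definition vword :: "('l \<times> nat) list \<Rightarrow> ('l \<times> nat) list \<Rightarrow> 'l falg" where
  "vword X Y = fword (xword X @ yword Y)"

lemma xword_simps [simp]:
  "xword [] = []" "xword ((s, c) # X) = (Prop s, Alpha c) # xword X" "xword (X @ X') = xword X @ xword X'"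
  by (simp_all add: xword_def)

lemma yword_simps [simp]:
  "yword [] = []" "yword ((t, c) # Y) = (Alpha c, Prop t) # yword Y" "yword (Y @ Y') = yword Y @ yword Y'"
  by (simp_all add: yword_def)

lemma Kid_trans: "p - q \<in> Kid \<Longrightarrow> q - r \<in> Kid \<Longrightarrow> p - r \<in> Kid"
  using Kid_add[of "p - q" "q - r"] by simp

lemma xword_swap:
  "fword (u @ (Prop s, Alpha c) # (Prop s', Alpha c') # v) + fword (u @ (Prop s', Alpha c') # (Prop s, Alpha c) # v) \<in> Kid"
  using fword_swap[of u "Prop s" "Alpha c" "Prop s'" "Alpha c'" v] by (simp add: lpar_def fconst_uminus)

lemma yword_swap:
  "fword (u @ (Alpha c, Prop s) # (Alpha c', Prop s') # v) + fword (u @ (Alpha c', Prop s') # (Alpha c, Prop s) # v) \<in> Kid"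
  using fword_swap[of u "Alpha c" "Prop s" "Alpha c'" "Prop s'" v] by (simp add: lpar_def fconst_uminus)

lemma yword_move_front:
  "fword (u @ yword (A @ y # B)) - (- 1) ^ length A * fword (u @ yword (y # A @ B)) \<in> Kid"
proof (induction A arbitrary: u)
  case (Cons a A)
  obtain s c t d where [simp]: "a = (s, c)" "y = (t, d)" by (cases a; cases y) auto
  let ?r = "fword (u @ yword (a # y # A @ B))" and ?r' = "fword (u @ yword (y # a # A @ B))"
  have 1: "fword (u @ yword (a # A @ y # B)) - (- 1) ^ length A * ?r \<in> Kid"
    using Cons.IH[of "u @ yword [a]"] by simp
  have 2: "(- 1) ^ length A * ?r - (- 1) ^ length (a # A) * ?r' \<in> Kid"
    using Kid_mult_left[OF yword_swap[of u c s d t "yword (A @ B)"], of "(- 1) ^ length A"]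
    by (simp add: distrib_left)
  from Kid_trans[OF 1 2] show ?case by simp
qed (simp add: Kid_zero)

text \<open>A polarization is even and passes without signs; a bracket arises only at a letter
  creating \<open>Alpha c\<close>, the symbol that it annihilates.\<close>

lemma polarization_commute_yword:
  assumes "c \<notin> snd ` set Y"
  shows "fword (u @ (Alpha c', Alpha c) # yword Y @ v) - fword (u @ yword Y @ (Alpha c', Alpha c) # v) \<in> Kid"
  using assms
proof (induction Y arbitrary: u)
  case (Cons y Y)
  obtain t d where [simp]: "y = (t, d)" by (cases y)
  have "fword (u @ (Alpha c', Alpha c) # yword (y # Y) @ v)
      - fword ((u @ yword [y]) @ (Alpha c', Alpha c) # yword Y @ v) \<in> Kid"
    using fword_swap[of u "Alpha c'" "Alpha c" "Alpha d" "Prop t" "yword Y @ v"] Cons.prems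
    by (simp add: lpar_def)
  from Kid_trans[OF this Cons.IH] show ?case using Cons.prems by simp
qed (simp add: Kid_zero)

text \<open>Here the other term of the bracket matters: it arises only at a letter annihilating
  \<open>Alpha c'\<close>, the symbol that the polarization creates.\<close>

lemma polarization_commute_xword:
  assumes "c' \<notin> snd ` set X"
  shows "fword (u @ (Alpha c', Alpha c) # xword X @ v) - fword (u @ xword X @ (Alpha c', Alpha c) # v) \<in> Kid"
  using assms
proof (induction X arbitrary: u)
  case (Cons x X)
  obtain t d where [simp]: "x = (t, d)" by (cases x)
  have "fword (u @ (Alpha c', Alpha c) # xword (x # X) @ v)
      - fword ((u @ xword [x]) @ (Alpha c', Alpha c) # xword X @ v) \<in> Kid"
    using fword_swap[of u "Alpha c'" "Alpha c" "Prop t" "Alpha d" "xword X @ v"] Cons.prems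
    by (simp add: lpar_def)
  from Kid_trans[OF this Cons.IH] show ?case using Cons.prems by simp
qed (simp add: Kid_zero)

text \<open>On its way to the right end the polarization leaves one bracket for each letter with
  label \<open>c\<close>, whose label becomes \<open>c'\<close>. At the end nothing creates
  \<open>Alpha c\<close>, so the word is irregular.\<close>

lemma polarization_yword:
  "fword ((Alpha c', Alpha c) # yword Y)
     - (\<Sum>k<length Y. if snd (Y ! k) = c then fword (yword (Y[k := (fst (Y ! k), c')])) else 0) \<in> IrrF"
proof (induction Y)
  case Nil
  then show ?case using irregular_in_IrrF irregularI[of "Alpha c" "[]" "[]" "Alpha c'"] by simp
next
  case (Cons y Y)
  obtain t d where y [simp]: "y = (t, d)" by (cases y)
  let ?S = "\<Sum>k<length Y. if snd (Y ! k) = c then fword (yword (Y[k := (fst (Y ! k), c')])) else 0"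
  let ?b = "if c = d then fword ((Alpha c', Prop t) # yword Y) else 0"
  have 1: "fword ((Alpha c', Alpha c) # yword (y # Y))
      - (fword ((Alpha d, Prop t) # (Alpha c', Alpha c) # yword Y) + ?b) \<in> IrrF"
    using fword_swap[of "[]" "Alpha c'" "Alpha c" "Alpha d" "Prop t" "yword Y"]
    by (intro IrrF_K) (cases "c = d"; simp add: lpar_def)
  have 2: "fword ((Alpha d, Prop t) # (Alpha c', Alpha c) # yword Y) - fword [(Alpha d, Prop t)] * ?S \<in> IrrF"
    using IrrF_mult_left[OF Cons.IH, of "fword [(Alpha d, Prop t)]"]
    by (simp add: fword_Cons[of "(Alpha d, Prop t)" "_ # _"] right_diff_distrib)
  have "fword ((Alpha c', Alpha c) # yword (y # Y)) - (fword [(Alpha d, Prop t)] * ?S + ?b) \<in> IrrF"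
    using IrrF_add[OF 1 2] by (simp add: algebra_simps)
  moreover have "fword [(Alpha d, Prop t)] * ?S = (\<Sum>k<length Y. if snd (Y ! k) = c
       then fword (yword (y # Y[k := (fst (Y ! k), c')])) else 0)"
    by (simp add: sum_distrib_left fword_Cons[of _ "yword _"] if_distrib[of "(*) _"] cong: if_cong)
  ultimately show ?case
    by (cases "c = d")
      (simp_all add: sum.lessThan_Suc_shift add.commute eq_commute[of d c] del: sum.lessThan_Suc cong: if_cong)
qed

text \<open>Instead of the letter \<open>(s, c)\<close> one may use a fresh virtual symbol \<open>c'\<close>, followed by the
  polarization of \<open>c'\<close> into \<open>c\<close>.\<close>
lemma vword_fresh:
  assumes "c \<notin> snd ` set Y1" "c' \<notin> snd ` set X2" "c' \<notin> snd ` set Y1" "c' \<notin> snd ` set Y2"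
  shows "vword (X1 @ (s, c) # X2) (Y1 @ Y2)
     - (\<Sum>k<length Y2. if snd (Y2 ! k) = c
         then vword (X1 @ (s, c') # X2) (Y1 @ Y2[k := (fst (Y2 ! k), c')]) else 0) \<in> IrrF"
proof -
  let ?E = "(Alpha c', Alpha c)" and ?L = "xword X1" and ?M = "xword X2" and ?N = "yword Y1" and ?P = "yword Y2"
  let ?x = "(Prop s, Alpha c)" and ?x' = "(Prop s, Alpha c')"
  let ?S = "\<Sum>k<length Y2. if snd (Y2 ! k) = c
         then vword (X1 @ (s, c') # X2) (Y1 @ Y2[k := (fst (Y2 ! k), c')]) else 0"
  \<comment> \<open>The bracket of \<open>?x'\<close> and \<open>?E\<close> is \<open>?x\<close>.
    Hence \<open>?x\<close> may be replaced by the product of \<open>?x'\<close> and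
    \<open>?E\<close>, provided that the opposite order is in \<open>Irr\<close>; it is, since
    nothing to the right of \<open>?x'\<close> creates \<open>Alpha c'\<close>.\<close>
  have irr: "fword (?L @ ?E # ?x' # ?M @ ?N @ ?P) \<in> IrrF"
  proof -
    have "Alpha c' \<notin> fst ` set (?M @ ?N @ ?P)" using assms(3,4) by (fastforce simp: xword_def yword_def image_iff)
    then show ?thesis
      using irregularI[of "Alpha c'" "?M @ ?N @ ?P" "?L @ [?E]" "Prop s"] irregular_in_IrrF by fastforce
  qed
  have "fword (?L @ ?x' # ?E # ?M @ ?N @ ?P)
       - (fword (?L @ ?E # ?x' # ?M @ ?N @ ?P) + fword (?L @ ?x # ?M @ ?N @ ?P)) \<in> Kid"
    using fword_swap[of ?L "Prop s" "Alpha c'" "Alpha c'" "Alpha c" "?M @ ?N @ ?P"] by (simp add: lpar_def)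
  from IrrF_add[OF IrrF_K[OF this] irr]
  have "fword (?L @ ?x' # ?E # ?M @ ?N @ ?P) - fword (?L @ ?x # ?M @ ?N @ ?P) \<in> IrrF"
    by (simp add: algebra_simps)
  then have 1: "fword (?L @ ?x # ?M @ ?N @ ?P) - fword (?L @ ?x' # ?E # ?M @ ?N @ ?P) \<in> IrrF"
    by (rule IrrF_sym)
  have 2: "fword (?L @ ?x' # ?E # ?M @ ?N @ ?P) - fword (?L @ ?x' # ?M @ ?E # ?N @ ?P) \<in> IrrF"
    using polarization_commute_xword[OF assms(2), of "?L @ [?x']" c "?N @ ?P"] by (intro IrrF_K) simp
  have 3: "fword (?L @ ?x' # ?M @ ?E # ?N @ ?P) - fword (?L @ ?x' # ?M @ ?N @ ?E # ?P) \<in> IrrF"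
    using polarization_commute_yword[OF assms(1), of "?L @ ?x' # ?M" c' ?P] by (intro IrrF_K) simp
  let ?Q = "?L @ ?x' # ?M @ ?N"
  have "fword ?Q * (fword (?E # ?P)
     - (\<Sum>k<length Y2. if snd (Y2 ! k) = c then fword (yword (Y2[k := (fst (Y2 ! k), c')])) else 0)) \<in> IrrF"
    by (rule IrrF_mult_left) (rule polarization_yword)
  also have "fword ?Q * (fword (?E # ?P)
     - (\<Sum>k<length Y2. if snd (Y2 ! k) = c then fword (yword (Y2[k := (fst (Y2 ! k), c')])) else 0))
     = fword (?L @ ?x' # ?M @ ?N @ ?E # ?P) - ?S"
  proof -
    have "fword ?Q * fword (?E # ?P) = fword (?L @ ?x' # ?M @ ?N @ ?E # ?P)"
      using fword_append[of ?Q "?E # ?P"] by simp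
    moreover have "fword ?Q * fword (yword Z) = vword (X1 @ (s, c') # X2) (Y1 @ Z)" for Z
      using fword_append[of ?Q "yword Z"] by (simp add: vword_def)
    ultimately show ?thesis
      by (simp add: right_diff_distrib sum_distrib_left if_distrib[of "(*) _"] cong: if_cong)
  qed
  finally have 4: "fword (?L @ ?x' # ?M @ ?N @ ?E # ?P) - ?S \<in> IrrF" .
  show ?thesis
    using IrrF_trans[OF 1 IrrF_trans[OF 2 IrrF_trans[OF 3 4]]] by (simp add: vword_def)
qed

text \<open>The word of a one-column pair of tableaux whose rows are the pairs in \<open>L\<close>.
  The labels are arbitrary because the expansion introduces fresh ones.\<close>

definition cword :: "('l \<times> 'l) list \<Rightarrow> nat list \<Rightarrow> 'l falg" where
  "cword L es = vword (zip (map fst L) es) (zip (map snd L) es)"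

text \<open>With distinct labels only one letter of the second half carries the old label, so the
  sum from \<open>vword_fresh\<close> has a single term.\<close>

lemma cword_rename_step:
  assumes "length es = length L" "distinct es" "k < length L" "c' \<notin> set es"
  shows "cword L es - cword L (es[k := c']) \<in> IrrF"
proof -
  let ?X = "zip (map fst L) es" and ?Y = "zip (map snd L) es" and ?c = "es ! k"
  have X: "?X = take k ?X @ (fst (L ! k), ?c) # drop (Suc k) ?X"
    using id_take_nth_drop[of k ?X] assms by simp
  have nin: "c' \<notin> snd ` set (zip xs es)" for xs :: "'b list"
    using assms(4) by (auto dest!: set_zip_rightD)
  then have nin': "c' \<notin> snd ` set (drop n (zip xs es))" for xs :: "'b list" and n
    using set_drop_subset[of n "zip xs es"] by blast
  have "vword ?X ([] @ ?Y) - (\<Sum>j<length ?Y. if snd (?Y ! j) = ?c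
      then vword (take k ?X @ (fst (L ! k), c') # drop (Suc k) ?X) ([] @ ?Y[j := (fst (?Y ! j), c')]) else 0) \<in> IrrF"
    by (subst X, rule vword_fresh) (simp_all add: nin nin')
  also have "(\<Sum>j<length ?Y. if snd (?Y ! j) = ?c
      then vword (take k ?X @ (fst (L ! k), c') # drop (Suc k) ?X) ([] @ ?Y[j := (fst (?Y ! j), c')]) else 0)
    = (\<Sum>j<length L. if j = k
      then vword (take k ?X @ (fst (L ! k), c') # drop (Suc k) ?X) (?Y[j := (fst (?Y ! j), c')]) else 0)"
    using assms by (intro sum.cong) (auto simp: nth_eq_iff_index_eq)
  also have "\<dots> = vword (?X[k := (fst (L ! k), c')]) (?Y[k := (snd (L ! k), c')])"
    using assms by (simp add: upd_conv_take_nth_drop)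
  also have "\<dots> = cword L (es[k := c'])"
  proof -
    have "zip (map f L) (es[k := c']) = (zip (map f L) es)[k := (f (L ! k), c')]" for f :: "'a \<times> 'a \<Rightarrow> 'a"
      using assms by (intro nth_equalityI) (auto simp: nth_list_update)
    then show ?thesis by (simp add: cword_def)
  qed
  finally show ?thesis by (simp add: cword_def)
qed

lemma cword_rename_disjoint:
  assumes "length es = length L" "distinct es" "length es' = length L" "distinct es'"
    and "set es \<inter> set es' = {}"
  shows "cword L es - cword L es' \<in> IrrF"
proof -
  have "cword L es - cword L (take i es' @ drop i es) \<in> IrrF" if "i \<le> length L" for i
    using that
  proof (induction i)
    case (Suc i)
    let ?e = "take i es' @ drop i es"
    have "distinct ?e"
      using assms(2,4,5) set_take_subset[of i es'] set_drop_subset[of i es] by auto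
    moreover have "es' ! i \<notin> set (take i es')"
      using assms(3,4) Suc.prems by (auto simp: in_set_conv_nth nth_eq_iff_index_eq)
    moreover have "es' ! i \<in> set es'" using assms(3) Suc.prems by simp
    then have "es' ! i \<notin> set (drop i es)" using assms(5) set_drop_subset[of i es] by blast
    ultimately have d: "distinct ?e" "es' ! i \<notin> set ?e" by auto
    have "cword L ?e - cword L (?e[i := es' ! i]) \<in> IrrF"
      by (rule cword_rename_step) (use d assms Suc.prems in auto)
    also have "?e[i := es' ! i] = take (Suc i) es' @ drop (Suc i) es"
      using assms Suc.prems by (simp add: list_update_append take_Suc_conv_app_nth flip: Cons_nth_drop_Suc)
    finally have "cword L ?e - cword L (take (Suc i) es' @ drop (Suc i) es) \<in> IrrF" .
    with Suc show ?case using IrrF_trans by (meson Suc_leD)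
  qed (simp add: IrrF_zero)
  from this[of "length L"] assms show ?thesis by simp
qed

lemma ex_fresh_distinct: "finite A \<Longrightarrow> \<exists>es :: nat list. length es = n \<and> distinct es \<and> set es \<inter> A = {}"
proof -
  assume "finite A"
  then obtain k where "A \<subseteq> {..<k}" using finite_nat_iff_bounded by blast
  then show ?thesis by (intro exI[of _ "[k..<k + n]"]) auto
qed

text \<open>If the label lists overlap, renaming one label at a time could create a repetition; the
  detour through fresh labels avoids it.\<close>

lemma cword_rename:
  assumes "length es = length L" "distinct es" "length es' = length L" "distinct es'"
  shows "cword L es - cword L es' \<in> IrrF"
proof -
  obtain es'' :: "nat list" where e: "length es'' = length L" "distinct es''" "set es'' \<inter> (set es \<union> set es') = {}"
    using ex_fresh_distinct[of "set es \<union> set es'" "length L"] by auto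
  have "cword L es - cword L es'' \<in> IrrF" "cword L es'' - cword L es' \<in> IrrF"
    by (rule cword_rename_disjoint; use assms e in blast)+
  then show ?thesis by (rule IrrF_trans)
qed

text \<open>The letters are odd, but two rows are exchanged in both halves at once, so the two signs
  cancel.\<close>

lemma cword_swap:
  assumes "length e1 = length A" "length e2 = length B"
  shows "cword (A @ x # y # B) (e1 @ a # b # e2) - cword (A @ y # x # B) (e1 @ b # a # e2) \<in> Kid"
proof -
  let ?X1 = "zip (map fst A) e1" and ?X2 = "zip (map fst B) e2"
  let ?Y1 = "zip (map snd A) e1" and ?Y2 = "zip (map snd B) e2"
  let ?x = "(fst x, a)" and ?y = "(fst y, b)" and ?x' = "(snd x, a)" and ?y' = "(snd y, b)"
  have "vword (?X1 @ ?x # ?y # ?X2) (?Y1 @ ?x' # ?y' # ?Y2)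
      - - vword (?X1 @ ?y # ?x # ?X2) (?Y1 @ ?x' # ?y' # ?Y2) \<in> Kid"
    using xword_swap[of "xword ?X1" "fst x" a "fst y" b "xword ?X2 @ yword (?Y1 @ ?x' # ?y' # ?Y2)"]
    by (simp add: vword_def)
  moreover have "- vword (?X1 @ ?y # ?x # ?X2) (?Y1 @ ?x' # ?y' # ?Y2)
      - vword (?X1 @ ?y # ?x # ?X2) (?Y1 @ ?y' # ?x' # ?Y2) \<in> Kid"
    using Kid_uminus[OF yword_swap[of "xword (?X1 @ ?y # ?x # ?X2) @ yword ?Y1" a "snd x" b "snd y" "yword ?Y2"]]
    by (simp add: vword_def)
  ultimately have "vword (?X1 @ ?x # ?y # ?X2) (?Y1 @ ?x' # ?y' # ?Y2)
      - vword (?X1 @ ?y # ?x # ?X2) (?Y1 @ ?y' # ?x' # ?Y2) \<in> Kid"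
    by (rule Kid_trans)
  then show ?thesis using assms by (simp add: cword_def)
qed

text \<open>The counterpart of the commutativity of monomials: after an exchange of rows the labels
  can be renamed back to their order. Hence the value on a monomial does not depend on how its
  factors are listed.\<close>

lemma cword_mset:
  assumes "mset L = mset L'"
  shows "cword L [0..<length L] - cword L' [0..<length L'] \<in> IrrF"
proof -
  have "length L = length L' \<and> cword L [0..<length L] - cword L' [0..<length L'] \<in> IrrF"
    using assms
  proof (induction rule: mset_eq_swap_induct)
    case (trans a b c)
    then show ?case using IrrF_trans by auto
  next
    case (swap A x y B)
    let ?n = "length A" and ?N = "Suc (Suc (length A + length B))"
    let ?e2 = "[Suc (Suc ?n)..<?N]"
    have e: "[0..<?N] = [0..<?n] @ ?n # Suc ?n # ?e2"
    proof -
      have "[0..<?N] = [0..<?n] @ [?n..<?N]" using upt_add_eq_append[of 0 ?n "Suc (Suc (length B))"] by simp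
      also have "[?n..<?N] = ?n # [Suc ?n..<?N]" by (rule upt_conv_Cons) simp
      also have "[Suc ?n..<?N] = Suc ?n # ?e2" by (rule upt_conv_Cons) simp
      finally show ?thesis .
    qed
    have "cword (A @ x # y # B) ([0..<?n] @ ?n # Suc ?n # ?e2)
        - cword (A @ y # x # B) ([0..<?n] @ Suc ?n # ?n # ?e2) \<in> IrrF"
      by (intro IrrF_K cword_swap) (simp_all del: upt_Suc)
    moreover have "cword (A @ y # x # B) ([0..<?n] @ Suc ?n # ?n # ?e2) - cword (A @ y # x # B) [0..<?N] \<in> IrrF"
      by (rule cword_rename) (auto simp del: upt_Suc)
    ultimately have "cword (A @ x # y # B) [0..<?N] - cword (A @ y # x # B) [0..<?N] \<in> IrrF"
      unfolding e by (rule IrrF_trans)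
    then show ?case by simp
  qed (simp add: IrrF_zero)
  then show ?thesis by (rule conjunct2)
qed

lemma devirtualizable_vword:
  assumes "mset (map snd X) = mset (map snd Y)" shows "devirtualizable (vword X Y)"
proof -
  have x: "filter_mset is_virtual (mset (map fst (xword X))) = {#}"
          "filter_mset is_virtual (mset (map snd (yword Y))) = {#}"
    by (auto simp: xword_def yword_def filter_mset_eq_conv)
  have y: "mset (map snd (xword X)) = image_mset Alpha (mset (map snd X))"
       "mset (map fst (yword Y)) = image_mset Alpha (mset (map snd Y))"
    by (simp_all add: xword_def yword_def multiset.map_comp comp_def case_prod_beta)
  have "balanced (xword X @ yword Y)"
    unfolding balanced_def map_append mset_append filter_union_mset x y assms by simp
  then show ?thesis
    unfolding vword_def by (rule balanced_devirtualizable)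
qed

text \<open>Row expansion of the determinant with entries \<open>(s|t)\<close> if the labels of \<open>s\<close> and \<open>t\<close> agree
  and 0 otherwise.\<close>
fun laplace :: "('l \<times> nat) list \<Rightarrow> ('l \<times> nat) list \<Rightarrow> 'l cpoly" where
  "laplace [] Y = 1"
| "laplace ((s, c) # X) Y = (\<Sum>k<length Y. if snd (Y ! k) = c
     then (- 1) ^ k * pvar s (fst (Y ! k)) * laplace X (take k Y @ drop (Suc k) Y) else 0)"

definition monom :: "('l \<times> 'l) list \<Rightarrow> 'l cpoly" where
  "monom L = prod_list (map (\<lambda>(s, t). pvar s t) L)"

text \<open>\<open>L\<close> with the labels \<open>es\<close> is the part already expanded into one
  column, \<open>X\<close> and \<open>Y\<close> are what remains. \<open>N\<close>, the total number
  of rows, is fixed because \<psi> will contain a sign depending on it.\<close>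

lemma vword_laplace:
  assumes add: "\<And>p q. \<psi> (p + q) = \<psi> p + \<psi> q"
    and sgn: "\<And>k p. \<psi> ((- 1) ^ k * p) = (- 1) ^ k * \<psi> p"
    and base: "\<And>L es. length L = N \<Longrightarrow> length es = N \<Longrightarrow> distinct es \<Longrightarrow> cword L es - \<psi> (monom L) \<in> IrrF"
    and "length L + length X = N" "length Y = length X" "length es = length L" "distinct es"
    and "set es \<inter> snd ` set X = {}"
  shows "vword (zip (map fst L) es @ X) (zip (map snd L) es @ Y) - \<psi> (monom L * laplace X Y) \<in> IrrF"
  using assms(4-)
proof (induction X arbitrary: L es Y)
  case Nil
  then show ?case using base[of L es] by (simp add: cword_def)
next
  case (Cons x X)
  obtain s c where x: "x = (s, c)" by (cases x)
  have psi0: "\<psi> 0 = 0" using add[of 0 0] by simp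
  have psi_sum: "\<psi> (\<Sum>k\<in>I. h k) = (\<Sum>k\<in>I. \<psi> (h k))" for h and I :: "nat set"
    by (induction I rule: infinite_finite_induct) (simp_all add: psi0 add)
  obtain c' where c': "c' \<notin> set es \<union> snd ` set X \<union> snd ` set Y"
    using ex_new_if_finite[of "set es \<union> snd ` set X \<union> snd ` set Y"] by auto
  let ?del = "\<lambda>k. take k Y @ drop (Suc k) Y" and ?t = "\<lambda>k. fst (Y ! k)"
  let ?T = "\<lambda>k. vword (zip (map fst L) es @ (s, c') # X) (zip (map snd L) es @ Y[k := (?t k, c')])"
  let ?m = "\<lambda>k. (- 1) ^ k * \<psi> (monom (L @ [(s, ?t k)]) * laplace X (?del k))"
  \<comment> \<open>The finished part of the second half takes the place of \<open>Y1\<close> in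
    \<open>vword_fresh\<close>, so the new polarization leaves it unchanged.\<close>
  have "c \<notin> set es" using Cons.prems x by auto
  then have 1: "vword (zip (map fst L) es @ (s, c) # X) (zip (map snd L) es @ Y)
      - (\<Sum>k<length Y. if snd (Y ! k) = c then ?T k else 0) \<in> IrrF"
    by (intro vword_fresh) (use c' in \<open>auto dest!: set_zip_rightD\<close>)
  have 2: "(\<Sum>k<length Y. if snd (Y ! k) = c then ?T k else 0)
      - (\<Sum>k<length Y. if snd (Y ! k) = c then ?m k else 0) \<in> IrrF"
  proof -
    have "?T k - ?m k \<in> IrrF" if k: "k < length Y" for k
    proof -
      let ?L = "L @ [(s, ?t k)]" and ?es = "es @ [c']"
      let ?V = "vword (zip (map fst ?L) ?es @ X) (zip (map snd ?L) ?es @ ?del k)"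
      have "?V - \<psi> (monom ?L * laplace X (?del k)) \<in> IrrF"
        by (rule Cons.IH) (use Cons.prems c' k in auto)
      from IrrF_mult_left[OF this, of "(- 1) ^ k"]
      have "(- 1) ^ k * ?V - ?m k \<in> IrrF" by (simp add: right_diff_distrib)
      moreover have "?T k - (- 1) ^ k * ?V \<in> IrrF"
        using yword_move_front[of "xword (zip (map fst L) es @ (s, c') # X) @ yword (zip (map snd L) es)"
            "take k Y" "(?t k, c')" "drop (Suc k) Y"] k Cons.prems
        by (intro IrrF_K) (simp add: vword_def upd_conv_take_nth_drop min_def)
      ultimately show ?thesis using IrrF_trans by blast
    qed
    then show ?thesis
      unfolding sum_subtractf[symmetric] by (intro IrrF_sum) (auto simp: IrrF_zero)
  qed
  have 3: "(\<Sum>k<length Y. if snd (Y ! k) = c then ?m k else 0) = \<psi> (monom L * laplace ((s, c) # X) Y)"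
  proof -
    have "monom L * laplace ((s, c) # X) Y = (\<Sum>k<length Y. if snd (Y ! k) = c
        then (- 1) ^ k * (monom (L @ [(s, ?t k)]) * laplace X (?del k)) else 0)"
      unfolding laplace.simps sum_distrib_left by (intro sum.cong) (auto simp: monom_def ac_simps)
    then show ?thesis by (simp add: psi_sum psi0 sgn if_distrib[of \<psi>] cong: if_cong)
  qed
  show ?case unfolding x using IrrF_trans[OF 1 2] unfolding 3 .
qed

section \<open>Bitableaux as determinants\<close>

text \<open>Block triangularity: a row from \<open>X1\<close> has no entry in the columns
  \<open>Y2\<close>. As \<open>Y1\<close> comes first, the column indices, and with them the signs,
  are those of the smaller expansion.\<close>

lemma laplace_append:
  assumes "length X1 = length Y1" "snd ` set X1 \<inter> snd ` set Y2 = {}"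
  shows "laplace (X1 @ X2) (Y1 @ Y2) = laplace X1 Y1 * laplace X2 Y2"
  using assms
proof (induction X1 arbitrary: Y1)
  case (Cons x X1)
  obtain s c where x: "x = (s, c)" by (cases x)
  have c: "snd ((Y1 @ Y2) ! k) \<noteq> c" if "length Y1 \<le> k" "k < length (Y1 @ Y2)" for k
  proof -
    have "(Y1 @ Y2) ! k \<in> set Y2" using that by (simp add: nth_append)
    then show ?thesis using Cons.prems(2) x by force
  qed
  let ?f = "\<lambda>k. if snd ((Y1 @ Y2) ! k) = c then (- 1) ^ k * pvar s (fst ((Y1 @ Y2) ! k)) *
      laplace (X1 @ X2) (take k (Y1 @ Y2) @ drop (Suc k) (Y1 @ Y2)) else 0"
  have "laplace ((x # X1) @ X2) (Y1 @ Y2) = sum ?f {..<length (Y1 @ Y2)}" by (simp add: x)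
  also have "\<dots> = sum ?f {..<length Y1}"
  proof (rule sum.mono_neutral_right)
    show "\<forall>k\<in>{..<length (Y1 @ Y2)} - {..<length Y1}. ?f k = 0"
      using c by (simp add: not_less)
  qed auto
  also have "\<dots> = (\<Sum>k<length Y1. (if snd (Y1 ! k) = c then (- 1) ^ k * pvar s (fst (Y1 ! k)) *
      laplace X1 (take k Y1 @ drop (Suc k) Y1) else 0) * laplace X2 Y2)"
  proof (rule sum.cong)
    fix k assume k: "k \<in> {..<length Y1}"
    have "laplace (X1 @ X2) ((take k Y1 @ drop (Suc k) Y1) @ Y2)
        = laplace X1 (take k Y1 @ drop (Suc k) Y1) * laplace X2 Y2"
      by (rule Cons.IH) (use Cons.prems k in auto)
    then show "?f k = (if snd (Y1 ! k) = c then (- 1) ^ k * pvar s (fst (Y1 ! k)) *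
      laplace X1 (take k Y1 @ drop (Suc k) Y1) else 0) * laplace X2 Y2"
      using k by (simp add: nth_append mult.assoc)
  qed simp
  also have "\<dots> = laplace (x # X1) Y1 * laplace X2 Y2"
    by (simp add: x sum_distrib_right)
  finally show ?case .
qed simp

lemma laplace_eq_det:
  assumes "length w = length v"
  shows "laplace (map (\<lambda>s. (s, c)) w) (map (\<lambda>t. (t, c)) v)
     = det (mat (length w) (length w) (\<lambda>(i, j). pvar (w ! i) (v ! j)))"
  using assms
proof (induction w arbitrary: v)
  case Nil
  then show ?case by (simp add: det_dim_zero)
next
  case (Cons s w)
  let ?n = "length v" and ?del = "\<lambda>k. take k v @ drop (Suc k) v"
  let ?A = "mat ?n ?n (\<lambda>(i, j). pvar ((s # w) ! i) (v ! j))"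
  have n: "?n = Suc (length w)" using Cons.prems by simp
  have "det ?A = (\<Sum>k<?n. ?A $$ (0, k) * cofactor ?A 0 k)"
    by (rule laplace_expansion_row[where n = ?n]) (simp_all add: n)
  also have "\<dots> = (\<Sum>k<?n. (- 1) ^ k * pvar s (v ! k) * laplace (map (\<lambda>s. (s, c)) w) (map (\<lambda>t. (t, c)) (?del k)))"
  proof (rule sum.cong)
    fix k assume k: "k \<in> {..<?n}"
    have "mat_delete ?A 0 k = mat (length w) (length w) (\<lambda>(i, j). pvar (w ! i) (?del k ! j))"
      using k n by (intro eq_matI) (auto simp: mat_delete_def nth_append min_def)
    moreover have "length w = length (?del k)" using k n by simp
    ultimately have d: "det (mat_delete ?A 0 k) = laplace (map (\<lambda>s. (s, c)) w) (map (\<lambda>t. (t, c)) (?del k))"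
      using Cons.IH[of "?del k"] by (simp only:)
    have a: "?A $$ (0, k) = pvar s (v ! k)" using k n by simp
    show "?A $$ (0, k) * cofactor ?A 0 k
        = (- 1) ^ k * pvar s (v ! k) * laplace (map (\<lambda>s. (s, c)) w) (map (\<lambda>t. (t, c)) (?del k))"
      unfolding cofactor_def a d by (simp only: add_0 ac_simps)
  qed simp
  also have "\<dots> = laplace (map (\<lambda>s. (s, c)) (s # w)) (map (\<lambda>t. (t, c)) v)"
    by (simp add: take_map drop_map)
  finally show ?case using n by simp
qed

lemma biproduct_eq_laplace:
  assumes "length w = length v"
  shows "biproduct w v = (- 1) ^ (length w choose 2) * laplace (map (\<lambda>s. (s, c)) w) (map (\<lambda>t. (t, c)) v)"
proof -
  let ?A = "mat (length w) (length w) (\<lambda>(i, j). pvar (w ! i) (v ! j))"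
  have "det ?A = (\<Sum>\<sigma> \<in> {\<sigma>. \<sigma> permutes {0..<length w}}.
        of_int (sign \<sigma>) * (\<Prod>r=0..<length w. ?A $$ (r, \<sigma> r)))"
    by (subst det_def'[where n = "length w"]) simp_all
  also have "\<dots> = (\<Sum>\<sigma> \<in> {\<sigma>. \<sigma> permutes {0..<length w}}.
        of_int (sign \<sigma>) * (\<Prod>r=0..<length w. pvar (w ! r) (v ! (\<sigma> r))))"
    by (intro sum.cong refl arg_cong2[of _ _ _ _ "(*)"] prod.cong) (auto dest: permutes_in_image)
  finally show ?thesis
    using laplace_eq_det[OF assms] by (simp add: biproduct_def Let_def lessThan_atLeast0)
qed

text \<open>The label is the row index, as in \<open>C_\<lambda>\<close>. In \<open>laplace\<close>
  it annuls the entries that pair different rows.\<close>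

definition labelled_rows :: "nat \<Rightarrow> 'a list list \<Rightarrow> ('a \<times> nat) list" where
  "labelled_rows m S = concat (map (\<lambda>r. map (\<lambda>s. (s, r)) (S ! r)) [0..<m])"

lemma labelled_rows_Suc:
  "labelled_rows 0 S = []" "labelled_rows (Suc m) S = labelled_rows m S @ map (\<lambda>s. (s, m)) (S ! m)"
  by (simp_all add: labelled_rows_def)

lemma length_labelled_rows: "length (labelled_rows m S) = (\<Sum>r<m. length (S ! r))"
  by (induction m) (simp_all add: labelled_rows_Suc)

lemma snd_labelled_rows: "snd ` set (labelled_rows m S) \<subseteq> {..<m}"
  by (auto simp: labelled_rows_def)

lemma choose_2_add: "(m + n) choose 2 = (m choose 2) + (n choose 2) + n * m"
proof (induction m)
  case (Suc m)
  then show ?case by (simp add: numeral_2_eq_2)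
qed simp

text \<open>The sign of a bitableau and the signs of its biproducts combine to the sign of the longest
  permutation of all its entries.\<close>
lemma bitableau_eq_laplace:
  fixes S T :: "'l list list"
  assumes "shape S = shape T"
  shows "bitableau S T = (- 1) ^ (length (labelled_rows (length S) S) choose 2)
    * laplace (labelled_rows (length S) S) (labelled_rows (length S) T)"
proof -
  have len: "length (S ! r) = length (T ! r)" if "r < length S" for r
    using assms that unfolding shape_def by (metis length_map nth_map)
  have "(- 1) ^ (\<Sum>k\<in>{1..<m}. length (S ! k) * (\<Sum>h<k. length (T ! h))) * (\<Prod>r<m. biproduct (S ! r) (T ! r))
      = (- 1) ^ (length (labelled_rows m S) choose 2) * laplace (labelled_rows m S) (labelled_rows m T)"
    if "m \<le> length S" for m
    using that
  proof (induction m)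
    case (Suc m)
    let ?a = "length (labelled_rows m S)" and ?b = "length (S ! m)"
    let ?r = "laplace (map (\<lambda>s. (s, m)) (S ! m)) (map (\<lambda>t. (t, m)) (T ! m))"
    have T: "(\<Sum>h<m. length (T ! h)) = ?a"
      using Suc.prems by (simp add: length_labelled_rows len)
    \<comment> \<open>The case \<open>m = 0\<close> is separate because the index range starts at 1:
      the new index is not in it, and \<open>?a\<close> is 0.\<close>
    have e: "(\<Sum>k\<in>{1..<Suc m}. length (S ! k) * (\<Sum>h<k. length (T ! h)))
        = (\<Sum>k\<in>{1..<m}. length (S ! k) * (\<Sum>h<k. length (T ! h))) + ?b * ?a"
      by (cases "m = 0") (simp_all add: labelled_rows_Suc T)
    have l: "laplace (labelled_rows (Suc m) S) (labelled_rows (Suc m) T)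
        = laplace (labelled_rows m S) (labelled_rows m T) * ?r"
      unfolding labelled_rows_Suc
      by (rule laplace_append) (use Suc.prems snd_labelled_rows[of m S] in \<open>auto simp: length_labelled_rows len\<close>)
    have b: "biproduct (S ! m) (T ! m) = (- 1) ^ (?b choose 2) * ?r"
      by (rule biproduct_eq_laplace) (use len Suc.prems in simp)
    have "(- 1) ^ (\<Sum>k\<in>{1..<Suc m}. length (S ! k) * (\<Sum>h<k. length (T ! h))) * (\<Prod>r<Suc m. biproduct (S ! r) (T ! r))
      = ((- 1) ^ (\<Sum>k\<in>{1..<m}. length (S ! k) * (\<Sum>h<k. length (T ! h))) * (\<Prod>r<m. biproduct (S ! r) (T ! r)))
        * ((- 1) ^ (?b * ?a + (?b choose 2)) * ?r)"
      unfolding e b prod.lessThan_Suc power_add by (simp only: ac_simps)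
    also have "\<dots> = (- 1) ^ ((?a choose 2) + (?b choose 2) + ?b * ?a)
        * (laplace (labelled_rows m S) (labelled_rows m T) * ?r)"
      using Suc by (simp add: power_add ac_simps)
    also have "\<dots> = (- 1) ^ (length (labelled_rows (Suc m) S) choose 2)
        * laplace (labelled_rows (Suc m) S) (labelled_rows (Suc m) T)"
      unfolding l by (simp add: labelled_rows_Suc choose_2_add)
    finally show ?case .
  qed (simp add: labelled_rows_Suc numeral_2_eq_2)
  from this[of "length S"] show ?thesis by (simp add: bitableau_def)
qed

lemma capelli_word_eq_vword:
  assumes "length S = length T"
  shows "fword (capelli_word S T) = vword (labelled_rows (length S) S) (labelled_rows (length S) T)"
  using assms
  by (simp add: capelli_word_def vword_def xword_def yword_def labelled_rows_def map_concat comp_def)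

section \<open>The linear map\<close>

definition exponent :: "'a list \<Rightarrow> 'a \<Rightarrow>\<^sub>0 nat" where
  "exponent L = sum_list (map (\<lambda>x. Poly_Mapping.single x 1) L)"

lemma lookup_exponent: "Poly_Mapping.lookup (exponent L) x = count (mset L) x"
  by (induction L) (simp_all add: exponent_def lookup_add lookup_single when_def)

lemma exponent_eq_iff: "exponent L = exponent L' \<longleftrightarrow> mset L = mset L'"
  by (auto simp: poly_mapping_eq_iff multiset_eq_iff fun_eq_iff lookup_exponent)

lemma ex_exponent: "\<exists>L. exponent L = m"
proof (induction m rule: single_induct)
  case zero
  show ?case by (intro exI[of _ "[]"]) (simp add: exponent_def)
next
  case (add k c m)
  then obtain L where L: "exponent L = m" by blast
  have "exponent (replicate c k @ L) = Poly_Mapping.single k c + m"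
    by (rule poly_mapping_eqI) (simp add: lookup_exponent lookup_add lookup_single when_def flip: L)
  then show ?case by blast
qed

lemma monom_eq_single: "monom L = Poly_Mapping.single (exponent L) 1"
  by (induction L) (auto simp: monom_def exponent_def pvar_def mult_single)

definition listing :: "('a \<Rightarrow>\<^sub>0 nat) \<Rightarrow> 'a list" where
  "listing m = (SOME L. exponent L = m)"

lemma exponent_listing [simp]: "exponent (listing m) = m"
  unfolding listing_def by (rule someI_ex) (rule ex_exponent)

definition devirtualization :: "('l \<times> 'l) list \<Rightarrow> 'l falg" where
  "devirtualization L = (SOME u. in_Ugln u \<and> cword L [0..<length L] - u \<in> IrrF)"

lemma devirtualization:
  "in_Ugln (devirtualization L)" "cword L [0..<length L] - devirtualization L \<in> IrrF"
proof -
  have "devirtualizable (cword L [0..<length L])"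
    unfolding cword_def by (rule devirtualizable_vword) simp
  then have "\<exists>u. in_Ugln u \<and> cword L [0..<length L] - u \<in> IrrF" by (simp add: devirtualizable_def)
  from someI_ex[OF this] show "in_Ugln (devirtualization L)" "cword L [0..<length L] - devirtualization L \<in> IrrF"
    unfolding devirtualization_def by blast+
qed

text \<open>The sign is that of the bitableau of a column with N one-letter rows: the row with index
  k is preceded by k letters, and these numbers add up to \<open>N choose 2\<close>.\<close>

definition bitableaux_map :: "'l cpoly \<Rightarrow> 'l falg" where
  "bitableaux_map p = (\<Sum>m\<in>Poly_Mapping.keys p. fconst (Poly_Mapping.lookup p m)
     * ((- 1) ^ (length (listing m) choose 2) * devirtualization (listing m)))"

lemma bitableaux_map_superset:
  assumes "finite A" "Poly_Mapping.keys p \<subseteq> A"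
  shows "bitableaux_map p = (\<Sum>m\<in>A. fconst (Poly_Mapping.lookup p m)
     * ((- 1) ^ (length (listing m) choose 2) * devirtualization (listing m)))"
  unfolding bitableaux_map_def
  by (rule sum.mono_neutral_left) (use assms in \<open>auto simp: in_keys_iff\<close>)

lemma bitableaux_map_add: "bitableaux_map (p + q) = bitableaux_map p + bitableaux_map q"
proof -
  let ?A = "Poly_Mapping.keys p \<union> Poly_Mapping.keys q"
  show ?thesis
    using keys_add[of p q]
    by (simp add: bitableaux_map_superset[of ?A] lookup_add distrib_right sum.distrib fconst_add)
qed

lemma lookup_pconst_mult: "Poly_Mapping.lookup (pconst c * p) m = c * Poly_Mapping.lookup p m"
proof (induction p rule: single_induct)
  case (add k a p)
  then show ?case
    by (simp add: distrib_left lookup_add pconst_def mult_single lookup_single when_def)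
qed simp

lemma bitableaux_map_pconst_mult: "bitableaux_map (pconst c * p) = fconst c * bitableaux_map p"
proof -
  have "Poly_Mapping.keys (pconst c * p) \<subseteq> Poly_Mapping.keys p"
    by (auto simp: in_keys_iff lookup_pconst_mult)
  then show ?thesis
    by (simp add: bitableaux_map_superset[of "Poly_Mapping.keys p"] lookup_pconst_mult sum_distrib_left
        fconst_mult mult.assoc)
qed

lemma pconst_neg_one_power: "pconst ((- 1) ^ k) = (- 1) ^ k"
proof (induction k)
  case (Suc k)
  have "pconst (- 1 * (- 1) ^ k) = pconst (- 1) * (pconst ((- 1) ^ k) :: 'a cpoly)"
    by (simp add: pconst_def mult_single)
  moreover have "pconst (- 1) = (- 1 :: 'a cpoly)"
    by (simp add: pconst_def single_uminus)
  ultimately show ?case using Suc by simp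
qed (simp add: pconst_def)

lemma bitableaux_map_sign: "bitableaux_map ((- 1) ^ k * p) = (- 1) ^ k * bitableaux_map p"
  using bitableaux_map_pconst_mult[of "(- 1) ^ k" p] by (simp add: pconst_neg_one_power)

lemma in_Ugln_bitableaux_map: "in_Ugln (bitableaux_map p)"
  unfolding bitableaux_map_def fconst_neg_one_power[symmetric]
  by (intro in_Ugln_sum in_Ugln_fconst_mult devirtualization(1))

lemma neg_one_power_mult_self: "(- 1 :: 'a::ring_1) ^ k * ((- 1) ^ k * p) = p"
  by (cases "even k") simp_all

lemma cword_bitableaux_map:
  assumes "length es = length L" "distinct es"
  shows "cword L es - (- 1) ^ (length L choose 2) * bitableaux_map (monom L) \<in> IrrF"
proof -
  let ?L = "listing (exponent L)"
  have m: "mset ?L = mset L" using exponent_listing[of "exponent L"] by (simp only: exponent_eq_iff)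
  then have len: "length ?L = length L" by (metis size_mset)
  have "bitableaux_map (monom L) = (- 1) ^ (length L choose 2) * devirtualization ?L"
    by (simp add: bitableaux_map_def monom_eq_single len)
  then have eq: "(- 1) ^ (length L choose 2) * bitableaux_map (monom L) = devirtualization ?L"
    by (simp only: neg_one_power_mult_self)
  have 1: "cword L es - cword L [0..<length L] \<in> IrrF"
    by (rule cword_rename) (use assms in auto)
  have 2: "cword L [0..<length L] - cword ?L [0..<length ?L] \<in> IrrF"
    by (rule cword_mset) (simp only: m)
  show ?thesis
    unfolding eq by (rule IrrF_trans[OF 1 IrrF_trans[OF 2 devirtualization(2)]])
qed

lemma bitableaux_map_bitableau:
  fixes S T :: "'l list list"
  assumes "shape S = shape T"
  shows "fword (capelli_word S T) - bitableaux_map (bitableau S T) \<in> IrrF"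
proof -
  have len: "length S = length T" "\<And>r. r < length S \<Longrightarrow> length (S ! r) = length (T ! r)"
    using assms unfolding shape_def by (metis length_map, metis length_map nth_map)
  let ?X = "labelled_rows (length S) S" and ?Y = "labelled_rows (length S) T"
  let ?N = "length ?X"
  \<comment> \<open>The factor is the sign relating \<open>bitableau S T\<close> to its determinant,
    and in degree \<open>?N\<close> it also undoes the sign in the values of
    \<open>bitableaux_map\<close> on monomials.\<close>
  let ?psi = "\<lambda>p. (- 1) ^ (?N choose 2) * bitableaux_map p"
  have "vword (zip (map fst ([] :: ('l \<times> 'l) list)) [] @ ?X) (zip (map snd ([] :: ('l \<times> 'l) list)) [] @ ?Y)
      - ?psi (monom [] * laplace ?X ?Y) \<in> IrrF"
  proof (rule vword_laplace[where \<psi> = ?psi and N = ?N and L = "[]" and es = "[]"])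
    show "?psi ((- 1) ^ k * p) = (- 1) ^ k * ?psi p" for k p
      unfolding bitableaux_map_sign by (simp add: minus_one_power_iff)
    show "cword L es - ?psi (monom L) \<in> IrrF"
      if "length L = ?N" "length es = ?N" "distinct es" for L :: "('l \<times> 'l) list" and es
      using cword_bitableaux_map[of es L] that by simp
  qed (use len in \<open>auto simp: bitableaux_map_add distrib_left length_labelled_rows\<close>)
  then show ?thesis
    using bitableau_eq_laplace[OF assms] capelli_word_eq_vword[OF len(1)]
    by (simp add: bitableaux_map_sign monom_def)
qed

lemma monom_eq_bitableau:
  obtains S T :: "'l list list" and k where "young_tableau S" "young_tableau T" "shape S = shape T"
    "monom L = (- 1) ^ k * bitableau S T"
proof -
  let ?S = "map (\<lambda>(s, t). [s]) L" and ?T = "map (\<lambda>(s, t). [t]) L"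
  have sh: "shape ?S = replicate (length L) 1" "shape ?T = replicate (length L) 1"
    by (simp_all add: shape_def comp_def case_prod_beta map_replicate_const)
  have b: "biproduct [s] [t] = pvar s t" for s t :: 'l
    by (simp add: biproduct_def lessThan_Suc permutes_sing numeral_2_eq_2)
  have "(\<Prod>r<length ?S. biproduct (?S ! r) (?T ! r)) = monom L"
    by (simp add: monom_def prod.list_conv_set_nth case_prod_beta b atLeast0LessThan)
  then have "\<exists>k. bitableau ?S ?T = (- 1) ^ k * monom L"
    unfolding bitableau_def by (intro exI) (rule arg_cong)
  then obtain k where "bitableau ?S ?T = (- 1) ^ k * monom L" ..
  then have "monom L = (- 1) ^ k * bitableau ?S ?T" by (simp only: neg_one_power_mult_self)
  moreover have "young_tableau ?S" "young_tableau ?T"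
    by (auto simp: young_tableau_def sh sorted_wrt_iff_nth_less)
  moreover have "shape ?S = shape ?T" unfolding sh ..
  ultimately show thesis by (intro that)
qed

theorem mainTheorem1:
  fixes dummy :: "'l::finite itself"
  shows "\<exists>f :: 'l cpoly \<Rightarrow> 'l falg.
           linear_to_U f \<and> maps_bitableaux_to_capelli f \<and>
           (\<forall>g. linear_to_U g \<and> maps_bitableaux_to_capelli g \<longrightarrow> (\<forall>p. f p - g p \<in> Kid))"
proof -
  have lin: "linear_to_U (bitableaux_map :: 'l cpoly \<Rightarrow> 'l falg)"
    unfolding linear_to_U_def
    by (simp add: in_Ugln_bitableaux_map bitableaux_map_add bitableaux_map_pconst_mult fmul_eq_times Kid_zero)
  have cap: "maps_bitableaux_to_capelli (bitableaux_map :: 'l cpoly \<Rightarrow> 'l falg)"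
    unfolding maps_bitableaux_to_capelli_def is_capelli_bitableau_def
    by (simp add: in_Ugln_bitableaux_map bitableaux_map_bitableau)
  have "bitableaux_map p - g p \<in> Kid"
    if g: "linear_to_U g" "maps_bitableaux_to_capelli g" for g :: "'l cpoly \<Rightarrow> 'l falg" and p
  proof -
    let ?f = "bitableaux_map :: 'l cpoly \<Rightarrow> 'l falg"
    have scale: "?f (pconst c * p) - g (pconst c * p) \<in> Kid" if "?f p - g p \<in> Kid" for c p
    proof -
      have "g (pconst c * p) - fconst c * g p \<in> Kid"
        using g(1) by (simp add: linear_to_U_def fmul_eq_times)
      from Kid_diff[OF Kid_mult_left[OF that, of "fconst c"] this]
      show ?thesis by (simp add: bitableaux_map_pconst_mult right_diff_distrib)
    qed
    have bit: "?f (bitableau S T) - g (bitableau S T) \<in> Kid"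
      if "young_tableau S" "young_tableau T" "shape S = shape T" for S T
    proof (rule Ugln_Int_IrrF)
      have "is_capelli_bitableau S T (?f (bitableau S T))" "is_capelli_bitableau S T (g (bitableau S T))"
        using that cap g(2) by (auto simp: maps_bitableaux_to_capelli_def)
      then have u: "in_Ugln (?f (bitableau S T))" "in_Ugln (g (bitableau S T))"
        and i: "fword (capelli_word S T) - ?f (bitableau S T) \<in> IrrF"
          "fword (capelli_word S T) - g (bitableau S T) \<in> IrrF"
        by (simp_all add: is_capelli_bitableau_def)
      show "in_Ugln (?f (bitableau S T) - g (bitableau S T))" using u by (rule in_Ugln_diff)
      show "?f (bitableau S T) - g (bitableau S T) \<in> IrrF"
        using IrrF_sym[OF i(1)] i(2) by (rule IrrF_trans)
    qed
    have mon: "?f (monom L) - g (monom L) \<in> Kid" for L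
    proof -
      obtain S T :: "'l list list" and k where ST: "young_tableau S" "young_tableau T" "shape S = shape T"
        "monom L = (- 1) ^ k * bitableau S T" by (rule monom_eq_bitableau)
      then show ?thesis
        using scale[OF bit[OF ST(1-3)], of "(- 1) ^ k"] by (simp add: pconst_neg_one_power)
    qed
    show ?thesis
    proof (induction p rule: single_induct)
      case zero
      \<comment> \<open>Linearity of \<open>g\<close> holds only modulo \<open>Kid\<close>, so its
        value at 0 is reached by scaling some monomial with 0.\<close>
      show ?case using scale[OF mon[of "[]"], of 0] by (simp add: pconst_def)
    next
      case (add m c p)
      have "Poly_Mapping.single m c = pconst c * monom (listing m)"
        by (simp add: monom_eq_single pconst_def mult_single)
      then have s: "?f (Poly_Mapping.single m c) - g (Poly_Mapping.single m c) \<in> Kid"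
        using scale[OF mon, of c] by simp
      let ?s = "Poly_Mapping.single m c"
      have "g (?s + p) - (g ?s + g p) \<in> Kid"
        using g(1) by (simp add: linear_to_U_def)
      from Kid_diff[OF Kid_add[OF s add] this]
      show ?case by (simp add: bitableaux_map_add algebra_simps)
    qed
  qed
  then show ?thesis using lin cap by blast
qed

end
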